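(* Let $k$ be a field of characteristic not two or three. Let $\mathfrak{g}=\mathfrak{g}_0\oplus\mathfrak{g}_1$ be a finite-dimensional Lie superalgebra over $k$, with bracket $\{\ ,\ \}$, such that the even part $\mathfrak{g}_0$ is a three-dimensional simple Lie algebra over $k$, and let $$\mathcal{Z}(\mathfrak{g}):=\{x\in\mathfrak{g}\mid \{x,y\}=0\ \ \forall y\in\mathfrak{g}\}.$$ Then one of the following three cases holds: (a) $\{\mathfrak{g}_1,\mathfrak{g}_1\}=\{0\}$; (b) $\mathfrak{g}_1=(\mathfrak{g}_0\oplus k)\oplus\mathcal{Z}(\mathfrak{g})$, in the following sense: as a representation of $\mathfrak{g}_0$, $\mathfrak{g}_1$ can be identified with the direct sum of the adjoint representation $\mathfrak{g}_0$, a one-dimensional trivial representation $k$, and $\mathcal{Z}(\mathfrak{g})$, in such a way that the only non-trivial brackets on $\mathfrak{g}_1$ are given by $\{v,\lambda\}=\{\lambda,v\}=\lambda v$ for $v\in\mathfrak{g}_0\subset\mathfrak{g}_1$ and $\lambda\in k\subset\mathfrak{g}_1$, where the right-hand side is understood as an element of the even part $\mathfrak{g}_0$ (so $\{\mathfrak{g}_0,\mathfrak{g}_0\}=0$ and $\{k,k\}=0$ for these odd summands); (c) $\mathfrak{g}\cong\mathfrak{osp}_k(1|2)\oplus\mathcal{Z}(\mathfrak{g})$ as Lie superalgebras.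
   Context: A Lie superalgebra over $k$ is a $\mathbb{Z}_2$-graded vector space $\mathfrak{g}=\mathfrak{g}_0\oplus\mathfrak{g}_1$ with a bilinear bracket $\{\ ,\ \}$ such that $\{\mathfrak{g}_\alpha,\mathfrak{g}_\beta\}\subseteq\mathfrak{g}_{\alpha+\beta}$, $\{x,y\}=-(-1)^{|x||y|}\{y,x\}$, and $(-1)^{|x||z|}\{x,\{y,z\}\}+(-1)^{|y||x|}\{y,\{z,x\}\}+(-1)^{|z||y|}\{z,\{x,y\}\}=0$ for all homogeneous $x,y,z$ (where $|x|$ is the parity of $x$). In particular $\mathfrak{g}_0$ is a Lie algebra and $\mathfrak{g}_1$ is a representation of $\mathfrak{g}_0$ via $x(v)=\{x,v\}$. $\mathfrak{osp}_k(1|2)$ denotes the Lie superalgebra with even part $\mathfrak{sl}(2,k)$, odd part the standard representation $k^2$ of $\mathfrak{sl}(2,k)$, and bracket on the odd part given by $$\{(a,b),(c,d)\}=\begin{pmatrix}-(ad+bc)&2ac\\-2bd&ad+bc\end{pmatrix}.$$ *)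

theory Defs
  imports "HOL-Analysis.Analysis" "HOL-Library.Z2"
begin

section \<open>Linear algebra on subsets of a vector space\<close>

definition linear_iso_on ::
    "('k \<Rightarrow> 'v \<Rightarrow> 'v::ab_group_add) \<Rightarrow> 'v set \<Rightarrow> ('k \<Rightarrow> 'w \<Rightarrow> 'w::ab_group_add) \<Rightarrow> 'w set \<Rightarrow> ('v \<Rightarrow> 'w) \<Rightarrow> bool"
  where "linear_iso_on s V t W f \<longleftrightarrow>
    bij_betw f V W \<and>
    (\<forall>x\<in>V. \<forall>y\<in>V. f (x + y) = f x + f y) \<and>
    (\<forall>c. \<forall>x\<in>V. f (s c x) = t c (f x))"

definition bilinear_on ::
    "('k \<Rightarrow> 'v \<Rightarrow> 'v::ab_group_add) \<Rightarrow> 'v set \<Rightarrow> ('v \<Rightarrow> 'v \<Rightarrow> 'v) \<Rightarrow> bool"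
  where "bilinear_on s V b \<longleftrightarrow>
    (\<forall>x\<in>V. \<forall>y\<in>V. \<forall>z\<in>V. b (x + y) z = b x z + b y z \<and> b z (x + y) = b z x + b z y) \<and>
    (\<forall>c. \<forall>x\<in>V. \<forall>y\<in>V. b (s c x) y = s c (b x y) \<and> b x (s c y) = s c (b x y))"


section \<open>Lie algebras\<close>

locale lie_algebra = vector_space s
  for s :: "'k::field \<Rightarrow> 'v::ab_group_add \<Rightarrow> 'v" +
  fixes L :: "'v set" and b :: "'v \<Rightarrow> 'v \<Rightarrow> 'v"
  assumes subspace: "subspace L"
    and closed: "\<lbrakk>x \<in> L; y \<in> L\<rbrakk> \<Longrightarrow> b x y \<in> L"
    and bilinear: "bilinear_on s L b"
    and alternating: "x \<in> L \<Longrightarrow> b x x = 0"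
    and jacobi: "\<lbrakk>x \<in> L; y \<in> L; z \<in> L\<rbrakk> \<Longrightarrow> b x (b y z) + b y (b z x) + b z (b x y) = 0"

definition lie_ideal ::
    "('k::field \<Rightarrow> 'v::ab_group_add \<Rightarrow> 'v) \<Rightarrow> 'v set \<Rightarrow> ('v \<Rightarrow> 'v \<Rightarrow> 'v) \<Rightarrow> 'v set \<Rightarrow> bool"
  where "lie_ideal s L b I \<longleftrightarrow>
    module.subspace s I \<and> I \<subseteq> L \<and> (\<forall>x\<in>L. \<forall>y\<in>I. b x y \<in> I)"

locale simple_lie_algebra = lie_algebra +
  assumes nonabelian: "\<exists>x\<in>L. \<exists>y\<in>L. b x y \<noteq> 0"
    and ideals: "lie_ideal s L b I \<Longrightarrow> I = {0} \<or> I = L"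


section \<open>Lie superalgebras\<close>

text \<open>
  The graded pieces are subspaces of an ambient vector space, which may be larger than their sum.
  Parities are elements of the two-element field \<^typ>\<open>bit\<close>.
\<close>

record ('k, 'v) superalgebra =
  homog :: "bit \<Rightarrow> 'v set"
  smul :: "'k \<Rightarrow> 'v \<Rightarrow> 'v"
  brk :: "'v \<Rightarrow> 'v \<Rightarrow> 'v"

definition super_carrier :: "('k, 'v::ab_group_add) superalgebra \<Rightarrow> 'v set"
  where "super_carrier g = {x + y | x y. x \<in> homog g 0 \<and> y \<in> homog g 1}"

definition koszul_sign :: "bit \<Rightarrow> bit \<Rightarrow> 'k::field"
  where "koszul_sign \<alpha> \<beta> = (if \<alpha> * \<beta> = 1 then - 1 else 1)"

locale lie_superalgebra =
  fixes g :: "('k::field, 'v::ab_group_add) superalgebra"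
  assumes vector_space: "vector_space (smul g)"
    and subspace: "module.subspace (smul g) (homog g \<alpha>)"
    and direct: "homog g 0 \<inter> homog g 1 = {0}"
    and bilinear: "bilinear_on (smul g) (super_carrier g) (brk g)"
    and graded: "\<lbrakk>x \<in> homog g \<alpha>; y \<in> homog g \<beta>\<rbrakk> \<Longrightarrow> brk g x y \<in> homog g (\<alpha> + \<beta>)"
    and skew: "\<lbrakk>x \<in> homog g \<alpha>; y \<in> homog g \<beta>\<rbrakk> \<Longrightarrow>
      brk g x y = - smul g (koszul_sign \<alpha> \<beta>) (brk g y x)"
    and jacobi: "\<lbrakk>x \<in> homog g \<alpha>; y \<in> homog g \<beta>; z \<in> homog g \<gamma>\<rbrakk> \<Longrightarrow>
      smul g (koszul_sign \<alpha> \<gamma>) (brk g x (brk g y z)) +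
      smul g (koszul_sign \<beta> \<alpha>) (brk g y (brk g z x)) +
      smul g (koszul_sign \<gamma> \<beta>) (brk g z (brk g x y)) = 0"

definition finite_dimensional :: "('k::field, 'v::ab_group_add) superalgebra \<Rightarrow> bool"
  where "finite_dimensional g \<longleftrightarrow> (\<exists>B. finite B \<and> module.span (smul g) B = super_carrier g)"

definition super_iso ::
    "('k::field, 'v::ab_group_add) superalgebra \<Rightarrow> ('k, 'w::ab_group_add) superalgebra \<Rightarrow> bool"
  where "super_iso g h \<longleftrightarrow> (\<exists>f.
    linear_iso_on (smul g) (super_carrier g) (smul h) (super_carrier h) f \<and>
    (\<forall>\<alpha>. f ` homog g \<alpha> \<subseteq> homog h \<alpha>) \<and>
    (\<forall>x\<in>super_carrier g. \<forall>y\<in>super_carrier g. f (brk g x y) = brk h (f x) (f y)))"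

definition super_sum ::
    "('k::field, 'v::ab_group_add) superalgebra \<Rightarrow> ('k, 'w::ab_group_add) superalgebra \<Rightarrow>
     ('k, 'v \<times> 'w) superalgebra"
  where "super_sum g h =
    \<lparr>homog = (\<lambda>\<alpha>. homog g \<alpha> \<times> homog h \<alpha>),
     smul = module_prod.scale (smul g) (smul h),
     brk = (\<lambda>(x, y) (x', y'). (brk g x x', brk h y y'))\<rparr>"

definition center :: "('k::field, 'v::ab_group_add) superalgebra \<Rightarrow> 'v set"
  where "center g = {x \<in> super_carrier g. \<forall>y\<in>super_carrier g. brk g x y = 0}"

definition center_algebra ::
    "('k::field, 'v::ab_group_add) superalgebra \<Rightarrow> ('k, 'v) superalgebra"
  where "center_algebra g = g\<lparr>homog := \<lambda>\<alpha>. homog g \<alpha> \<inter> center g\<rparr>"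

lemma (in lie_superalgebra) super_carrier_center_algebra:
  "super_carrier (center_algebra g) = center g"
proof -
  interpret vector_space "smul g" by (rule vector_space)
  have z: "0 \<in> homog g \<alpha>" for \<alpha>
    using subspace_0[OF subspace] .
  have inc: "u \<in> homog g \<alpha> \<Longrightarrow> u \<in> super_carrier g" for u \<alpha>
    using z[of 0] z[of 1] by (cases \<alpha>) (force simp: super_carrier_def)+
  have add: "brk g (x + y) w = brk g x w + brk g y w" "brk g w (x + y) = brk g w x + brk g w y"
    if "x \<in> super_carrier g" "y \<in> super_carrier g" "w \<in> super_carrier g" for x y w
    using bilinear that unfolding bilinear_on_def by blast+
  have hom: "u \<in> center g \<and> v \<in> center g"
    if uv: "u \<in> homog g 0" "v \<in> homog g 1" "u + v \<in> center g" for u v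
  proof -
    have *: "brk g u y = 0 \<and> brk g v y = 0" if y: "y \<in> homog g \<beta>" for y \<beta>
    proof -
      have "brk g u y + brk g v y = 0"
        using uv y add(1) inc by (metis (mono_tags, lifting) center_def mem_Collect_eq)
      then have e: "brk g u y = - brk g v y"
        by (simp add: eq_neg_iff_add_eq_0)
      have 0: "brk g u y \<in> homog g \<beta>" and 1: "brk g v y \<in> homog g (1 + \<beta>)"
        using graded[OF uv(1) y] graded[OF uv(2) y] by (simp_all only: add_0)
      have "brk g u y \<in> homog g (1 + \<beta>)"
        unfolding e using 1 subspace_neg[OF subspace] by blast
      then have "brk g u y \<in> homog g 0 \<inter> homog g 1"
        using 0 by (cases \<beta>) auto
      then show ?thesis using direct e by auto
    qed
    have "brk g u w = 0 \<and> brk g v w = 0" if w: "w \<in> super_carrier g" for w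
    proof -
      obtain a b where ab: "w = a + b" "a \<in> homog g 0" "b \<in> homog g 1"
        using w by (auto simp: super_carrier_def)
      then show ?thesis
        using *[OF ab(2)] *[OF ab(3)] add(2)[of a b] inc uv by auto
    qed
    then show ?thesis using inc uv by (auto simp: center_def)
  qed
  show ?thesis
  proof (intro set_eqI iffI)
    fix x assume "x \<in> super_carrier (center_algebra g)"
    then obtain u v where "x = u + v" "u \<in> homog g 0" "v \<in> homog g 1" "u \<in> center g" "v \<in> center g"
      by (auto simp: super_carrier_def center_algebra_def)
    then show "x \<in> center g"
      using add(1)[of u v] by (auto simp: center_def super_carrier_def)
  next
    fix x assume x: "x \<in> center g"
    then obtain u v where "x = u + v" "u \<in> homog g 0" "v \<in> homog g 1"
      by (auto simp: super_carrier_def center_def)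
    then show "x \<in> super_carrier (center_algebra g)"
      using hom[of u v] x by (auto simp: super_carrier_def center_algebra_def)
  qed
qed


section \<open>The orthosymplectic Lie superalgebra $osp(1|2)$\<close>

definition osp_odd_brk :: "'k::field^2 \<Rightarrow> 'k^2 \<Rightarrow> 'k^2^2"
  where "osp_odd_brk v w =
    (let a = v $ 1; b = v $ 2; c = w $ 1; d = w $ 2
     in vector [vector [- (a * d + b * c), 2 * a * c],
                vector [- (2 * b * d), a * d + b * c]])"

text \<open>
  The pair \<open>(A, v)\<close> is the sum of the even element \<open>A\<close> and the odd element \<open>v\<close>; the ambient space is
  $gl_2 \times k^2$. The term \<open>- B *v v\<close> is the bracket of odd \<open>v\<close> with even \<open>B\<close>.
\<close>

definition osp12 :: "('k::field, ('k^2^2) \<times> ('k^2)) superalgebra"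
  where "osp12 =
    \<lparr>homog = (\<lambda>\<alpha>. if \<alpha> = 0 then {A. trace A = 0} \<times> {0} else {0} \<times> UNIV),
     smul = module_prod.scale (\<lambda>c. map_matrix ((*) c)) (*s),
     brk = (\<lambda>(A, v) (B, w). (A ** B - B ** A + osp_odd_brk v w, A *v w - B *v v))\<rparr>"


section \<open>Representations\<close>

record ('k, 'x, 'v) representation =
  rspace :: "'v set"
  rsmul :: "'k \<Rightarrow> 'v \<Rightarrow> 'v"
  act :: "'x \<Rightarrow> 'v \<Rightarrow> 'v"

definition rep_iso ::
    "'x set \<Rightarrow> ('k, 'x, 'v::ab_group_add) representation \<Rightarrow>
     ('k, 'x, 'w::ab_group_add) representation \<Rightarrow> ('v \<Rightarrow> 'w) \<Rightarrow> bool"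
  where "rep_iso L V W f \<longleftrightarrow>
    linear_iso_on (rsmul V) (rspace V) (rsmul W) (rspace W) f \<and>
    (\<forall>x\<in>L. \<forall>v\<in>rspace V. f (act V x v) = act W x (f v))"

definition rep_sum ::
    "('k::field, 'x, 'v::ab_group_add) representation \<Rightarrow>
     ('k, 'x, 'w::ab_group_add) representation \<Rightarrow> ('k, 'x, 'v \<times> 'w) representation"
  where "rep_sum V W =
    \<lparr>rspace = rspace V \<times> rspace W,
     rsmul = module_prod.scale (rsmul V) (rsmul W),
     act = (\<lambda>x (v, w). (act V x v, act W x w))\<rparr>"

definition trivial_rep :: "('k::field, 'x, 'k) representation"
  where "trivial_rep = \<lparr>rspace = UNIV, rsmul = (*), act = (\<lambda>_ _. 0)\<rparr>"

text \<open>A subspace of a Lie superalgebra that is stable under the even part, with the action by bracket.\<close>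

definition bracket_rep ::
    "('k, 'v) superalgebra \<Rightarrow> 'v set \<Rightarrow> ('k, 'v, 'v) representation"
  where "bracket_rep g V = \<lparr>rspace = V, rsmul = smul g, act = brk g\<rparr>"

end

theory Submission
  imports Defs
begin

text \<open>
  Let \<open>L\<close> and \<open>V\<close> be the even and odd parts. On \<open>L\<close> there is a nondegenerate symmetric form with
  \<open>[a, [b, c]] = F(a, b) c - F(a, c) b\<close>. If the odd bracket is nonzero, then \<open>H = {x, x} \<noteq> 0\<close> for some odd
  \<open>x\<close>; the Jacobi identity gives \<open>H x = 0\<close> and \<open>H z = -2 {x, z} x\<close>, so that \<open>H\<close> acts on \<open>V\<close> with small
  rank and satisfies a polynomial identity of low degree. This replaces complete reducibility, which
  is not available in positive characteristic.

  If \<open>H\<close> can be chosen with \<open>F(H, H) \<noteq> 0\<close>, then \<open>H\<^sup>3 = F(H, H) H\<close> on \<open>V\<close>, which forces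
  \<open>x = h + t\<close> with \<open>t\<close> invariant and \<open>h\<close> generating a copy of the adjoint representation; the map
  \<open>z \<mapsto> {t, z}\<close> splits it off, and \<open>L\<close> kills the kernel. Otherwise all \<open>{x, x}\<close> are isotropic, \<open>L\<close> contains an
  \<open>sl\<^sub>2\<close>-triple with \<open>{x, x} = 2 e\<close>, and \<open>e\<^sup>2 = 0\<close> on \<open>V\<close> forces \<open>h x\<close> to generate the standard representation,
  whose orthogonal for the odd bracket is central.
\<close>

section \<open>The invariant form of a three-dimensional simple Lie algebra\<close>

context vector_space
begin

lemma independent_triple:
  assumes "independent {x, y, z}" "card {x, y, z} = 3" "scale a x + scale b y + scale c z = 0"
  shows "a = 0" "b = 0" "c = 0"
proof -
  have d: "x \<noteq> y" "y \<noteq> z" "x \<noteq> z"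
    using assms(2) by (auto simp: card_insert_if split: if_splits)
  define u where "u v = (if v = x then a else if v = y then b else c)" for v
  have "(\<Sum>v\<in>{x, y, z}. scale (u v) v) = 0"
    using d assms(3) by (simp add: u_def add.assoc)
  then have "u v = 0" if "v \<in> {x, y, z}" for v
    using independentD[OF assms(1), of "{x, y, z}" u] that by blast
  from this[of x] this[of y] this[of z] show "a = 0" "b = 0" "c = 0"
    using d by (auto simp: u_def)
qed

lemma span_triple: "v \<in> span {x, y, z} \<longleftrightarrow> (\<exists>a b c. v = scale a x + scale b y + scale c z)"
proof -
  have "v \<in> span {x, y, z} \<longleftrightarrow> (\<exists>a b c. v - scale a x - scale b y - scale c z = 0)"
    by (simp add: span_insert)
  also have "\<dots> \<longleftrightarrow> (\<exists>a b c. v = scale a x + scale b y + scale c z)"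
    by (simp add: algebra_simps)
  finally show ?thesis .
qed

end

context lie_algebra
begin

lemma bracket_simps:
  assumes "x \<in> L" "y \<in> L" "z \<in> L"
  shows "b (x + y) z = b x z + b y z" "b z (x + y) = b z x + b z y"
    "b (s c x) y = s c (b x y)" "b x (s c y) = s c (b x y)"
  using bilinear assms unfolding bilinear_on_def by blast+

lemma anticomm:
  assumes "x \<in> L" "y \<in> L"
  shows "b y x = - b x y"
proof -
  have "b (x + y) (x + y) = 0"
    using assms by (simp add: alternating subspace_add[OF subspace])
  then have "b y x + b x y = 0"
    using assms by (simp add: alternating[OF assms(1)] alternating[OF assms(2)] bracket_simps subspace_add[OF subspace])
  then show ?thesis by (metis eq_neg_iff_add_eq_0)
qed

text \<open>Alternation leaves only the three cyclic brackets; their coefficients form the cross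
  product of the coordinate vectors.\<close>

lemma bracket_combination:
  assumes e: "e1 \<in> L" "e2 \<in> L" "e3 \<in> L"
  shows "b (s a1 e1 + s a2 e2 + s a3 e3) (s b1 e1 + s b2 e2 + s b3 e3) =
    s (a2 * b3 - a3 * b2) (b e2 e3) + s (a3 * b1 - a1 * b3) (b e3 e1) + s (a1 * b2 - a2 * b1) (b e1 e2)"
proof -
  have r: "b e2 e1 = - b e1 e2" "b e1 e3 = - b e3 e1" "b e3 e2 = - b e2 e3"
    "b e1 e1 = 0" "b e2 e2 = 0" "b e3 e3 = 0"
    using anticomm[OF e(1,2)] anticomm[OF e(3,1)] anticomm[OF e(2,3)] e by (simp_all add: alternating)
  have "b (s a1 e1 + s a2 e2 + s a3 e3) y = s a1 (b e1 y) + s a2 (b e2 y) + s a3 (b e3 y)" if "y \<in> L" for y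
    using e that by (simp add: bracket_simps subspace_add[OF subspace] subspace_scale[OF subspace])
  moreover have "b x (s b1 e1 + s b2 e2 + s b3 e3) = s b1 (b x e1) + s b2 (b x e2) + s b3 (b x e3)" if "x \<in> L" for x
    using e that by (simp add: bracket_simps subspace_add[OF subspace] subspace_scale[OF subspace])
  ultimately show ?thesis
    using e by (simp add: r subspace_add[OF subspace] subspace_scale[OF subspace]
      scale_left_diff_distrib scale_right_distrib scale_minus_right) (simp add: algebra_simps)
qed

end

context simple_lie_algebra
begin

text \<open>The derived algebra is an ideal, and it is nonzero because \<open>L\<close> is not
  abelian.\<close>

lemma perfect: "span {b x y | x y. x \<in> L \<and> y \<in> L} = L"
proof -
  let ?D = "span {b x y | x y. x \<in> L \<and> y \<in> L}"
  have D: "?D \<subseteq> L"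
    by (rule span_minimal) (auto simp: closed subspace)
  have "lie_ideal s L b ?D"
    using D by (auto simp: lie_ideal_def subspace_span intro!: span_base)
  moreover have "?D \<noteq> {0}"
  proof -
    obtain x y where xy: "x \<in> L" "y \<in> L" "b x y \<noteq> 0" using nonabelian by blast
    then have "b x y \<in> ?D" by (blast intro: span_base)
    then show ?thesis using xy by auto
  qed
  ultimately show ?thesis using ideals by blast
qed

text \<open>
  In a basis with \<open>[e\<^sub>2, e\<^sub>3] = \<Sum> m\<^sub>1\<^sub>j e\<^sub>j\<close> and its cyclic shifts, the Jacobi identity says that
  the matrix \<open>m\<close> is symmetric, and the form is minus its cofactor matrix.
\<close>

lemma cross_product_form:
  assumes "dim L = 3"
  obtains F :: "'b \<Rightarrow> 'b \<Rightarrow> 'a" where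
    "\<And>x y. F x y = F y x"
    "\<And>x y z. \<lbrakk>x \<in> L; y \<in> L\<rbrakk> \<Longrightarrow> F (x + y) z = F x z + F y z"
    "\<And>c x z. x \<in> L \<Longrightarrow> F (s c x) z = c * F x z"
    "\<And>x y z. \<lbrakk>x \<in> L; y \<in> L; z \<in> L\<rbrakk> \<Longrightarrow> b x (b y z) = s (F x y) z - s (F x z) y"
    "\<And>x. \<lbrakk>x \<in> L; \<forall>y\<in>L. F x y = 0\<rbrakk> \<Longrightarrow> x = 0"
proof -
  obtain B where B: "B \<subseteq> L" "independent B" "L \<subseteq> span B" "card B = 3"
    using basis_exists[of L] assms by metis
  then obtain e1 e2 e3 where Be: "B = {e1, e2, e3}" and ne: "e1 \<noteq> e2" "e1 \<noteq> e3" "e2 \<noteq> e3"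
    by (auto simp: card_3_iff)
  have e: "e1 \<in> L" "e2 \<in> L" "e3 \<in> L" using B Be by auto
  have LB: "L = span B" using B span_minimal[OF B(1) subspace] by blast
  have coord: "\<exists>a1 a2 a3. v = s a1 e1 + s a2 e2 + s a3 e3" if "v \<in> L" for v
    using that LB Be by (simp add: span_triple)
  \<comment> \<open>By \<open>perfect\<close> the cyclic brackets span \<open>L\<close>; being three
    vectors in dimension 3, they are distinct and independent, so their coefficients can be
    compared.\<close>
  let ?C = "{b e2 e3, b e3 e1, b e1 e2}"
  have CL: "?C \<subseteq> L" using e closed by auto
  have "{b x y | x y. x \<in> L \<and> y \<in> L} \<subseteq> span ?C"
  proof safe
    fix x y assume "x \<in> L" "y \<in> L"
    then obtain a1 a2 a3 b1 b2 b3 where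
      "x = s a1 e1 + s a2 e2 + s a3 e3" "y = s b1 e1 + s b2 e2 + s b3 e3"
      using coord by meson
    then show "b x y \<in> span ?C"
      unfolding span_triple using bracket_combination[OF e] by blast
  qed
  then have LC: "L \<subseteq> span ?C"
    using perfect span_minimal[OF _ subspace_span] by blast
  have "dim L \<le> card ?C" using LC by (intro dim_le_card) auto
  moreover have "card ?C \<le> 3" by (simp add: card_insert_if)
  ultimately have cC: "card ?C = 3" using assms by simp
  have iC: "independent ?C"
  proof -
    obtain B' where B': "B' \<subseteq> ?C" "independent B'" "?C \<subseteq> span B'" "card B' = dim ?C"
      using basis_exists by blast
    have "span ?C = L"
      using LC span_minimal[OF CL subspace] by blast
    then have "dim ?C = 3" using assms by (metis dim_span)
    then have "B' = ?C" using B' cC by (intro card_subset_eq) auto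
    then show ?thesis using B' by simp
  qed
  obtain m11 m12 m13 where m1: "b e2 e3 = s m11 e1 + s m12 e2 + s m13 e3"
    using coord[OF closed[OF e(2,3)]] by blast
  obtain m21 m22 m23 where m2: "b e3 e1 = s m21 e1 + s m22 e2 + s m23 e3"
    using coord[OF closed[OF e(3,1)]] by blast
  obtain m31 m32 m33 where m3: "b e1 e2 = s m31 e1 + s m32 e2 + s m33 e3"
    using coord[OF closed[OF e(1,2)]] by blast
  have J1: "b e1 (b e2 e3) = s m12 (b e1 e2) - s m13 (b e3 e1)"
    unfolding m1 using bracket_combination[OF e, of 1 0 0] by simp
  have J2: "b e2 (b e3 e1) = s m23 (b e2 e3) - s m21 (b e1 e2)"
    unfolding m2 using bracket_combination[OF e, of 0 1 0] by simp
  have J3: "b e3 (b e1 e2) = s m31 (b e3 e1) - s m32 (b e2 e3)"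
    unfolding m3 using bracket_combination[OF e, of 0 0 1] by simp
  \<comment> \<open>The Jacobi sum is a linear relation between the independent cyclic brackets,
    with the off-diagonal differences of \<open>m\<close> as coefficients.\<close>
  have "s (m23 - m32) (b e2 e3) + s (m31 - m13) (b e3 e1) + s (m12 - m21) (b e1 e2) =
    b e1 (b e2 e3) + b e2 (b e3 e1) + b e3 (b e1 e2)"
    unfolding J1 J2 J3 by (simp add: scale_left_diff_distrib algebra_simps)
  then have "s (m23 - m32) (b e2 e3) + s (m31 - m13) (b e3 e1) + s (m12 - m21) (b e1 e2) = 0"
    using jacobi[OF e] by simp
  from independent_triple[OF iC cC this] have sym: "m32 = m23" "m31 = m13" "m21 = m12" by auto
  let ?r = "representation B"
  define F where "F x y = - (
     (m22 * m33 - m23 * m23) * ?r x e1 * ?r y e1 + (m11 * m33 - m13 * m13) * ?r x e2 * ?r y e2 +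
     (m11 * m22 - m12 * m12) * ?r x e3 * ?r y e3 +
     (m13 * m23 - m12 * m33) * (?r x e1 * ?r y e2 + ?r x e2 * ?r y e1) +
     (m12 * m23 - m13 * m22) * (?r x e1 * ?r y e3 + ?r x e3 * ?r y e1) +
     (m12 * m13 - m11 * m23) * (?r x e2 * ?r y e3 + ?r x e3 * ?r y e2))" for x y
  have r: "v = s (?r v e1) e1 + s (?r v e2) e2 + s (?r v e3) e3" if "v \<in> L" for v
    using sum_representation_eq[OF B(2), of v B] that ne LB Be by (simp add: add.assoc)
  have cross: "b x (b y z) = s (F x y) z - s (F x z) y" if L: "x \<in> L" "y \<in> L" "z \<in> L" for x y z
  proof -
    define x1 x2 x3 y1 y2 y3 z1 z2 z3 where
      xyz: "x1 = ?r x e1" "x2 = ?r x e2" "x3 = ?r x e3" "y1 = ?r y e1" "y2 = ?r y e2" "y3 = ?r y e3"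
      "z1 = ?r z e1" "z2 = ?r z e2" "z3 = ?r z e3"
    note x = r[OF L(1), folded xyz] and y = r[OF L(2), folded xyz] and z = r[OF L(3), folded xyz]
    \<comment> \<open>In coordinates \<open>w\<close> is the cross product of \<open>y\<close> and
      \<open>z\<close>, and \<open>n = m w\<close> is their bracket. For symmetric \<open>m\<close>
      with cofactor matrix \<open>N\<close>, applying \<open>m\<close> to the cross product of
      \<open>x\<close> and \<open>m w\<close> gives the cross product of \<open>N x\<close> and
      \<open>w\<close>; expanding this double cross product produces \<open>F = - N\<close>.\<close>
    define w1 w2 w3 where w: "w1 = y2 * z3 - y3 * z2" "w2 = y3 * z1 - y1 * z3" "w3 = y1 * z2 - y2 * z1"
    have comb: "s a (b e2 e3) + s b' (b e3 e1) + s c (b e1 e2) =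
      s (a * m11 + b' * m12 + c * m13) e1 + s (a * m12 + b' * m22 + c * m23) e2 +
      s (a * m13 + b' * m23 + c * m33) e3" for a b' c
      unfolding m1 m2 m3 sym by (simp add: scale_right_distrib scale_left_distrib algebra_simps)
    define n1 n2 n3 where n: "n1 = w1 * m11 + w2 * m12 + w3 * m13" "n2 = w1 * m12 + w2 * m22 + w3 * m23"
      "n3 = w1 * m13 + w2 * m23 + w3 * m33"
    have yz: "b y z = s n1 e1 + s n2 e2 + s n3 e3"
      by (subst y, subst z) (simp add: bracket_combination[OF e] comb flip: w n)
    have lhs: "b x (b y z) =
      s ((x2 * n3 - x3 * n2) * m11 + (x3 * n1 - x1 * n3) * m12 + (x1 * n2 - x2 * n1) * m13) e1 +
      s ((x2 * n3 - x3 * n2) * m12 + (x3 * n1 - x1 * n3) * m22 + (x1 * n2 - x2 * n1) * m23) e2 +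
      s ((x2 * n3 - x3 * n2) * m13 + (x3 * n1 - x1 * n3) * m23 + (x1 * n2 - x2 * n1) * m33) e3"
      unfolding yz by (subst x) (simp add: bracket_combination[OF e] comb)
    have rhs: "s \<beta> z - s \<gamma> y = s (\<beta> * z1 - \<gamma> * y1) e1 + s (\<beta> * z2 - \<gamma> * y2) e2 + s (\<beta> * z3 - \<gamma> * y3) e3"
      for \<beta> \<gamma>
      by (subst z, subst y) (simp add: scale_right_distrib scale_left_diff_distrib algebra_simps)
    show ?thesis
      unfolding lhs rhs F_def xyz[symmetric] n w
      by (intro arg_cong2[where f = "(+)"] arg_cong2[where f = s] refl; algebra)
  qed
  have nondeg: "x = 0" if x: "x \<in> L" "\<forall>y\<in>L. F x y = 0" for x
  proof (rule ccontr)
    assume nz: "x \<noteq> 0"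
    \<comment> \<open>For \<open>x\<close> in the radical of \<open>F\<close>, the identity
      \<open>cross\<close> shows that \<open>x\<close> annihilates all brackets, hence
      \<open>L\<close> by perfectness. The line of \<open>x\<close> is then a nonzero ideal of
      dimension 1.\<close>
    let ?K = "{y \<in> L. b x y = 0}"
    have "subspace ?K"
      using x by (auto simp: subspace_def subspace_0[OF subspace] subspace_add[OF subspace]
          subspace_scale[OF subspace] bracket_simps) (metis bracket_simps(4) scale_zero_left subspace_0[OF subspace])
    moreover have "{b x y | x y. x \<in> L \<and> y \<in> L} \<subseteq> ?K"
      using x cross closed by auto
    ultimately have K: "L \<subseteq> ?K" using perfect span_minimal by blast
    have yx: "b y (s c x) = 0" if "y \<in> L" for y c
    proof -
      have "b x y = 0" using K that by blast
      then show ?thesis using anticomm[OF x(1) that] x(1) that by (simp add: bracket_simps)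
    qed
    have "lie_ideal s L b (span {x})"
      unfolding lie_ideal_def span_singleton
      using yx subspace_span[of "{x}"] subspace_scale[OF subspace x(1)]
      by (auto simp: span_singleton intro: range_eqI[of _ _ 0])
    then have "span {x} = L" using ideals nz by (metis singletonD span_base singletonI)
    then have "dim L = 1" using dim_span[of "{x}"] dim_eq_card_independent[of "{x}"] nz
      by (simp add: independent_insert independent_empty)
    then show False using assms by simp
  qed
  show ?thesis
  proof (rule that[of F])
    show "F x y = F y x" for x y unfolding F_def by (simp add: algebra_simps)
    show "F (x + y) z = F x z + F y z" if "x \<in> L" "y \<in> L" for x y z
      using that unfolding F_def LB representation_add[OF B(2)] by (simp add: representation_add[OF B(2)] algebra_simps)
    show "F (s c x) z = c * F x z" if "x \<in> L" for x z c
      using that unfolding F_def LB by (simp add: representation_scale[OF B(2)] algebra_simps)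
  qed (use cross nondeg in auto)
qed

end

section \<open>Lie superalgebras in characteristic other than 2 and 3\<close>

lemma two_three_nonzero:
  assumes "CHAR('k::field) \<noteq> 2" "CHAR('k) \<noteq> 3"
  shows "(2::'k) \<noteq> 0" "(3::'k) \<noteq> 0"
proof -
  have "prime (2::nat)" "prime (3::nat)" by simp_all
  then have "\<not> CHAR('k) dvd 2" "\<not> CHAR('k) dvd 3"
    using assms CHAR_not_1[where 'a = 'k] unfolding prime_nat_iff by (metis One_nat_def)+
  then show "(2::'k) \<noteq> 0" "(3::'k) \<noteq> 0"
    using of_nat_eq_0_iff_char_dvd[of 2, where 'a = 'k] of_nat_eq_0_iff_char_dvd[of 3, where 'a = 'k]
    by simp_all
qed

locale lie_superalgebra_char_not_2_3 = lie_superalgebra g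
  for g :: "('k::field, 'v::ab_group_add) superalgebra" +
  assumes two_nz [simp]: "(2::'k) \<noteq> 0" and three_nz [simp]: "(3::'k) \<noteq> 0"
begin

sublocale vs: vector_space "smul g" by (rule vector_space)

abbreviation L where "L \<equiv> homog g 0"
abbreviation V where "V \<equiv> homog g 1"
abbreviation C where "C \<equiv> super_carrier g"
abbreviation bracket (infixr "\<cdot>" 73) where "x \<cdot> y \<equiv> brk g x y"
abbreviation scal (infixr "\<odot>" 75) where "c \<odot> y \<equiv> smul g c y"

lemma numerals_nonzero [simp]: "(4::'k) \<noteq> 0" "(6::'k) \<noteq> 0" "(12::'k) \<noteq> 0"
proof -
  have "(4::'k) = 2 * 2" "(6::'k) = 2 * 3" "(12::'k) = 2 * 2 * 3" by simp_all
  then show "(4::'k) \<noteq> 0" "(6::'k) \<noteq> 0" "(12::'k) \<noteq> 0" by (metis mult_eq_0_iff two_nz three_nz)+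
qed

lemma scale_two: "2 \<odot> x = x + x"
  by (metis one_add_one vs.scale_left_distrib vs.scale_one)

lemma double_eq_0 [simp]: "x + x = 0 \<longleftrightarrow> x = (0::'v)"
  unfolding scale_two[symmetric] by simp

section \<open>Closure and linearity of the graded bracket\<close>

lemma homog_closed [simp]:
  "0 \<in> homog g \<alpha>"
  "\<lbrakk>x \<in> homog g \<alpha>; y \<in> homog g \<alpha>\<rbrakk> \<Longrightarrow> x + y \<in> homog g \<alpha>"
  "\<lbrakk>x \<in> homog g \<alpha>; y \<in> homog g \<alpha>\<rbrakk> \<Longrightarrow> x - y \<in> homog g \<alpha>"
  "x \<in> homog g \<alpha> \<Longrightarrow> - x \<in> homog g \<alpha>"
  "x \<in> homog g \<alpha> \<Longrightarrow> c \<odot> x \<in> homog g \<alpha>"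
  by (fact vs.subspace_0[OF subspace] vs.subspace_add[OF subspace] vs.subspace_diff[OF subspace]
      vs.subspace_neg[OF subspace] vs.subspace_scale[OF subspace])+

lemma brk_closed [simp]:
  "\<lbrakk>x \<in> L; y \<in> L\<rbrakk> \<Longrightarrow> x \<cdot> y \<in> L"
  "\<lbrakk>x \<in> L; y \<in> V\<rbrakk> \<Longrightarrow> x \<cdot> y \<in> V"
  "\<lbrakk>x \<in> V; y \<in> L\<rbrakk> \<Longrightarrow> x \<cdot> y \<in> V"
  "\<lbrakk>x \<in> V; y \<in> V\<rbrakk> \<Longrightarrow> x \<cdot> y \<in> L"
  using graded[of x 0 y 0] graded[of x 0 y 1] graded[of x 1 y 0] graded[of x 1 y 1] by simp_all

lemma homog_carrier [simp]: "x \<in> L \<Longrightarrow> x \<in> C" "x \<in> V \<Longrightarrow> x \<in> C"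
  unfolding super_carrier_def
  by simp_all (metis add.left_neutral add.right_neutral homog_closed(1))+

lemma carrier_cases:
  assumes "x \<in> C" obtains a v where "a \<in> L" "v \<in> V" "x = a + v"
  using assms by (auto simp: super_carrier_def)

lemma subspace_carrier: "vs.subspace C"
proof -
  have "C = {x + y |x y. x \<in> L \<and> y \<in> V}" by (simp add: super_carrier_def)
  then show ?thesis using vs.subspace_sums[OF subspace subspace] by simp
qed

lemma carrier_closed [simp]:
  "0 \<in> C"
  "\<lbrakk>x \<in> C; y \<in> C\<rbrakk> \<Longrightarrow> x + y \<in> C"
  "\<lbrakk>x \<in> C; y \<in> C\<rbrakk> \<Longrightarrow> x - y \<in> C"
  "x \<in> C \<Longrightarrow> - x \<in> C"
  "x \<in> C \<Longrightarrow> c \<odot> x \<in> C"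
  by (fact vs.subspace_0[OF subspace_carrier] vs.subspace_add[OF subspace_carrier]
      vs.subspace_diff[OF subspace_carrier] vs.subspace_neg[OF subspace_carrier]
      vs.subspace_scale[OF subspace_carrier])+

lemma brk_linear [simp]:
  "\<lbrakk>x \<in> C; y \<in> C; z \<in> C\<rbrakk> \<Longrightarrow> (x + y) \<cdot> z = x \<cdot> z + y \<cdot> z"
  "\<lbrakk>x \<in> C; y \<in> C; z \<in> C\<rbrakk> \<Longrightarrow> z \<cdot> (x + y) = z \<cdot> x + z \<cdot> y"
  "\<lbrakk>x \<in> C; z \<in> C\<rbrakk> \<Longrightarrow> (c \<odot> x) \<cdot> z = c \<odot> (x \<cdot> z)"
  "\<lbrakk>x \<in> C; z \<in> C\<rbrakk> \<Longrightarrow> z \<cdot> (c \<odot> x) = c \<odot> (z \<cdot> x)"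
  using bilinear unfolding bilinear_on_def by blast+

lemma brk_0 [simp]: "x \<in> C \<Longrightarrow> 0 \<cdot> x = 0" "x \<in> C \<Longrightarrow> x \<cdot> 0 = 0"
  using brk_linear(3,4)[of 0 x 0] by simp_all

lemma brk_minus [simp]:
  "\<lbrakk>x \<in> C; z \<in> C\<rbrakk> \<Longrightarrow> (- x) \<cdot> z = - (x \<cdot> z)"
  "\<lbrakk>x \<in> C; z \<in> C\<rbrakk> \<Longrightarrow> z \<cdot> (- x) = - (z \<cdot> x)"
  using brk_linear(3,4)[of x z "-1"] by simp_all

lemma brk_diff [simp]:
  "\<lbrakk>x \<in> C; y \<in> C; z \<in> C\<rbrakk> \<Longrightarrow> (x - y) \<cdot> z = x \<cdot> z - y \<cdot> z"
  "\<lbrakk>x \<in> C; y \<in> C; z \<in> C\<rbrakk> \<Longrightarrow> z \<cdot> (x - y) = z \<cdot> x - z \<cdot> y"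
  using brk_linear(1,2)[of x "- y" z] by simp_all

lemma brk_in_carrier [simp]: "x \<in> C \<Longrightarrow> y \<in> C \<Longrightarrow> x \<cdot> y \<in> C"
  by (elim carrier_cases) simp

lemma even_skew:
  assumes "a \<in> L" "x \<in> C" shows "x \<cdot> a = - (a \<cdot> x)"
proof -
  obtain b v where "b \<in> L" "v \<in> V" "x = b + v" using assms(2) by (rule carrier_cases)
  then show ?thesis
    using assms(1) skew[of b 0 a 0] skew[of v 1 a 0] by (simp add: koszul_sign_def)
qed

lemma odd_commute: "\<lbrakk>x \<in> V; y \<in> V\<rbrakk> \<Longrightarrow> x \<cdot> y = y \<cdot> x"
  using skew[of x 1 y 1] by (simp add: koszul_sign_def)

text \<open>This is the Jacobi identity with an even first entry. The one remaining Koszul sign is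
  absorbed by exchanging \<open>y\<close> with \<open>a \<cdot> x\<close>, and bilinearity extends
  the rule beyond homogeneous elements.\<close>

lemma leibniz:
  assumes a: "a \<in> L" and "x \<in> C" "y \<in> C"
  shows "a \<cdot> (x \<cdot> y) = (a \<cdot> x) \<cdot> y + x \<cdot> (a \<cdot> y)"
proof -
  have *: "a \<cdot> (x \<cdot> y) = (a \<cdot> x) \<cdot> y + x \<cdot> (a \<cdot> y)" if "x \<in> homog g \<alpha>" "y \<in> homog g \<beta>" for x y \<alpha> \<beta>
  proof -
    have C: "x \<in> C" "y \<in> C" using that by (metis homog_carrier bit_not_zero_iff)+
    have "a \<cdot> x \<in> homog g \<alpha>" using graded[OF a that(1)] by (simp only: add_0)
    then have 1: "y \<cdot> (a \<cdot> x) = - (koszul_sign \<beta> \<alpha> \<odot> ((a \<cdot> x) \<cdot> y))" by (rule skew[OF that(2)])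
    have 2: "y \<cdot> a = - (a \<cdot> y)" by (rule even_skew[OF a C(2)])
    have "a \<cdot> (x \<cdot> y) - x \<cdot> (a \<cdot> y) + koszul_sign \<beta> \<alpha> \<odot> (y \<cdot> (a \<cdot> x)) = 0"
      using jacobi[OF a that] C a unfolding 2 by (simp add: koszul_sign_def)
    then show ?thesis unfolding 1 by (auto simp: koszul_sign_def algebra_simps split: if_splits)
  qed
  obtain b v where x: "b \<in> L" "v \<in> V" "x = b + v" using assms(2) by (rule carrier_cases)
  obtain b' v' where y: "b' \<in> L" "v' \<in> V" "y = b' + v'" using assms(3) by (rule carrier_cases)
  show ?thesis
    using *[OF x(1) y(1)] *[OF x(1) y(2)] *[OF x(2) y(1)] *[OF x(2) y(2)] x y a
    by (simp add: algebra_simps)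
qed

text \<open>On odd elements all three Koszul signs equal -1, and moving the even factor to the left
  changes every term by the same sign.\<close>

lemma odd_triple:
  assumes "x \<in> V" "y \<in> V" "z \<in> V"
  shows "(x \<cdot> y) \<cdot> z + (y \<cdot> z) \<cdot> x + (z \<cdot> x) \<cdot> y = 0"
proof -
  have "- (x \<cdot> (y \<cdot> z)) + - (y \<cdot> (z \<cdot> x)) + - (z \<cdot> (x \<cdot> y)) = 0"
    using jacobi[OF assms]
    by (simp only: koszul_sign_def mult_1 if_True simp_thms vs.scale_minus_left vs.scale_one)
  moreover have "x \<cdot> (y \<cdot> z) = - ((y \<cdot> z) \<cdot> x)" "y \<cdot> (z \<cdot> x) = - ((z \<cdot> x) \<cdot> y)"
    "z \<cdot> (x \<cdot> y) = - ((x \<cdot> y) \<cdot> z)"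
    using assms by (simp_all add: even_skew)
  ultimately show ?thesis by (simp add: ac_simps)
qed

text \<open>The Jacobi identity for \<open>x\<close>, \<open>x\<close>, \<open>z\<close> makes the
  square of \<open>x\<close> act on \<open>V\<close> with image among the vectors
  \<open>a \<cdot> x\<close> with \<open>a\<close> even, which bounds its rank.\<close>

lemma square_act:
  assumes "x \<in> V" "z \<in> V" shows "(x \<cdot> x) \<cdot> z = - (2 \<odot> ((x \<cdot> z) \<cdot> x))"
proof -
  have "(x \<cdot> x) \<cdot> z + ((x \<cdot> z) \<cdot> x + (x \<cdot> z) \<cdot> x) = 0"
    using odd_triple[OF assms(1) assms(1) assms(2)] odd_commute[OF assms] by (simp add: add.assoc)
  then show ?thesis by (simp only: scale_two eq_neg_iff_add_eq_0)
qed

text \<open>For \<open>z = x\<close> the formula \<open>square_act\<close> equates the vector with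
  -2 times itself, and 3 is invertible.\<close>

lemma square_act_self: assumes "x \<in> V" shows "(x \<cdot> x) \<cdot> x = 0"
proof -
  have "3 \<odot> ((x \<cdot> x) \<cdot> x) = 0"
    using square_act[OF assms assms] vs.scale_left_distrib[of 1 2 "(x \<cdot> x) \<cdot> x"]
    by (simp add: eq_neg_iff_add_eq_0)
  then show ?thesis by simp
qed

lemma square_leibniz:
  assumes "a \<in> L" "x \<in> V" shows "a \<cdot> (x \<cdot> x) = 2 \<odot> ((a \<cdot> x) \<cdot> x)"
  using leibniz[of a x x] assms odd_commute[of "a \<cdot> x" x] by (simp add: scale_two)

end

text \<open>The form \<open>F\<close> and its cross product identity stand in for simplicity and
  dimension three from here on.\<close>

locale cross_product_superalgebra = lie_superalgebra_char_not_2_3 +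
  fixes F :: "'b \<Rightarrow> 'b \<Rightarrow> 'a"
  assumes F_sym: "F a b = F b a"
    and F_add: "\<lbrakk>a \<in> L; b \<in> L\<rbrakk> \<Longrightarrow> F (a + b) e = F a e + F b e"
    and F_scale: "a \<in> L \<Longrightarrow> F (c \<odot> a) e = c * F a e"
    and F_cross: "\<lbrakk>a \<in> L; b \<in> L; e \<in> L\<rbrakk> \<Longrightarrow> a \<cdot> (b \<cdot> e) = F a b \<odot> e - F a e \<odot> b"
    and F_nondegenerate: "\<lbrakk>a \<in> L; \<forall>b\<in>L. F a b = 0\<rbrakk> \<Longrightarrow> a = 0"
    and nonabelian: "\<exists>a\<in>L. \<exists>b\<in>L. a \<cdot> b \<noteq> 0"
begin

section \<open>The invariant form, centralizers and the center\<close>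

lemma F_linear [simp]:
  "\<lbrakk>a \<in> L; b \<in> L\<rbrakk> \<Longrightarrow> F (a + b) e = F a e + F b e"
  "\<lbrakk>a \<in> L; b \<in> L\<rbrakk> \<Longrightarrow> F e (a + b) = F e a + F e b"
  "a \<in> L \<Longrightarrow> F (c \<odot> a) e = c * F a e"
  "a \<in> L \<Longrightarrow> F e (c \<odot> a) = c * F e a"
  "a \<in> L \<Longrightarrow> F (- a) e = - F a e"
  "a \<in> L \<Longrightarrow> F e (- a) = - F e a"
  "\<lbrakk>a \<in> L; b \<in> L\<rbrakk> \<Longrightarrow> F (a - b) e = F a e - F b e"
  "\<lbrakk>a \<in> L; b \<in> L\<rbrakk> \<Longrightarrow> F e (a - b) = F e a - F e b"
proof -
  show l: "\<lbrakk>a \<in> L; b \<in> L\<rbrakk> \<Longrightarrow> F (a + b) e = F a e + F b e"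
    "\<lbrakk>a \<in> L; b \<in> L\<rbrakk> \<Longrightarrow> F e (a + b) = F e a + F e b"
    "a \<in> L \<Longrightarrow> F (c \<odot> a) e = c * F a e"
    "a \<in> L \<Longrightarrow> F e (c \<odot> a) = c * F e a" for a b c
    using F_add F_scale by (simp_all add: F_sym[of e])
  show m: "a \<in> L \<Longrightarrow> F (- a) e = - F a e" "a \<in> L \<Longrightarrow> F e (- a) = - F e a" for a
    using l(3,4)[of a "-1"] by simp_all
  show "\<lbrakk>a \<in> L; b \<in> L\<rbrakk> \<Longrightarrow> F (a - b) e = F a e - F b e"
    "\<lbrakk>a \<in> L; b \<in> L\<rbrakk> \<Longrightarrow> F e (a - b) = F e a - F e b"
    using l(1,2)[of a "-b"] m by simp_all
qed

text \<open>Bracketing \<open>a \<cdot> b = 0\<close> with some \<open>e\<close> not orthogonal to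
  \<open>a\<close> gives a linear relation in which \<open>b\<close> has a nonzero
  coefficient.\<close>

lemma centralizer:
  assumes "a \<in> L" "a \<noteq> 0" "b \<in> L" "a \<cdot> b = 0" obtains c where "b = c \<odot> a"
proof -
  obtain e where e: "e \<in> L" "F a e \<noteq> 0" using F_nondegenerate assms by blast
  have "F e a \<odot> b - F e b \<odot> a = 0" using F_cross[of e a b] e assms by simp
  then have "F e a \<odot> b = F e b \<odot> a" by simp
  then have "b = (F e b / F e a) \<odot> a"
    using e F_sym[of e a] vs.scale_scale[of "1 / F e a" "F e a" b] by simp
  then show ?thesis by (rule that)
qed

lemma even_brk_self: "a \<in> L \<Longrightarrow> a \<cdot> a = 0"
  using even_skew[of a a] by (metis double_eq_0 eq_neg_iff_add_eq_0 homog_carrier(1))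

text \<open>The triple action of \<open>a\<close> on \<open>b\<close> is computed twice, with
  \<open>F_cross\<close> applied to the outer or to the inner brackets; the results differ by
  \<open>F a (a \<cdot> b) \<odot> a\<close>.\<close>

lemma F_brk_self:
  assumes "a \<in> L" "b \<in> L" shows "F a (a \<cdot> b) = 0"
proof -
  have "a \<cdot> (a \<cdot> (a \<cdot> b)) = F a a \<odot> (a \<cdot> b) - F a (a \<cdot> b) \<odot> a"
    using assms by (simp add: F_cross[of a a "a \<cdot> b"])
  moreover have "a \<cdot> (a \<cdot> (a \<cdot> b)) = F a a \<odot> (a \<cdot> b)"
    using assms by (simp add: F_cross[of a a b] even_brk_self)
  ultimately have "F a (a \<cdot> b) \<odot> a = 0" by simp
  moreover have "F 0 e = 0" for e using F_scale[of 0 0 e] by simp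
  ultimately show ?thesis by auto
qed

text \<open>A nonzero central \<open>a\<close> would have all of \<open>L\<close> as its
  centralizer, so \<open>L\<close> would be a line and hence abelian.\<close>

lemma even_center:
  assumes "a \<in> L" "\<And>b. b \<in> L \<Longrightarrow> b \<cdot> a = 0" shows "a = 0"
proof (rule ccontr)
  assume "a \<noteq> 0"
  then have *: "\<exists>c. b = c \<odot> a" if "b \<in> L" for b
    using centralizer[of a b] assms that even_skew[of b a] by (metis homog_carrier(1) neg_equal_0_iff_equal even_skew)
  have "b \<cdot> e = 0" if be: "b \<in> L" "e \<in> L" for b e
  proof -
    obtain c where "e = c \<odot> a" using * be by blast
    then show ?thesis using assms be by simp
  qed
  then show False using nonabelian by blast
qed

text \<open>By the Leibniz rule the bracket of two invariant odd vectors is central in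
  \<open>L\<close>.\<close>

lemma invariant_pair:
  assumes "x \<in> V" "y \<in> V" "\<And>a. a \<in> L \<Longrightarrow> a \<cdot> x = 0" "\<And>a. a \<in> L \<Longrightarrow> a \<cdot> y = 0"
  shows "x \<cdot> y = 0"
proof (rule even_center)
  show "x \<cdot> y \<in> L" using assms by simp
  show "a \<cdot> (x \<cdot> y) = 0" if "a \<in> L" for a
    using leibniz[OF that, of x y] assms(3,4)[OF that] assms(1,2) by simp
qed

text \<open>The homogeneous components of a central element are central, and
  \<open>even_center\<close> removes the even one.\<close>

lemma center_odd:
  assumes "z \<in> center g" shows "z \<in> V"
proof -
  have "z \<in> super_carrier (center_algebra g)" using assms by (simp add: super_carrier_center_algebra)
  then obtain a v where z: "z = a + v" "a \<in> L" "a \<in> center g" "v \<in> V"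
    by (auto simp: super_carrier_def center_algebra_def)
  have "b \<cdot> a = 0" if "b \<in> L" for b
    using that z even_skew[of a b] even_skew[of b a] by (auto simp: center_def)
  then have "a = 0" using z even_center by blast
  then show ?thesis using z by simp
qed

lemma centerI:
  assumes "z \<in> V" "\<And>a. a \<in> L \<Longrightarrow> a \<cdot> z = 0" "\<And>y. y \<in> V \<Longrightarrow> y \<cdot> z = 0"
  shows "z \<in> center g"
proof -
  have "z \<cdot> y = 0" if y: "y \<in> C" for y
  proof -
    obtain a v where "a \<in> L" "v \<in> V" "y = a + v" using y by (rule carrier_cases)
    then show ?thesis using assms even_skew[of a z] odd_commute[of z v] by simp
  qed
  then show ?thesis using assms(1) by (simp add: center_def)
qed

lemma center_act:
  assumes "z \<in> center g" "y \<in> C" shows "y \<cdot> z = 0" "z \<cdot> y = 0"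
proof -
  show *: "z \<cdot> y = 0" using assms by (simp add: center_def)
  have "z \<cdot> a = 0" if "a \<in> C" for a using assms that by (simp add: center_def)
  obtain a v where y: "a \<in> L" "v \<in> V" "y = a + v" using assms(2) by (rule carrier_cases)
  then have "a \<cdot> z = 0" "v \<cdot> z = 0"
    using assms(1) center_odd[OF assms(1)] even_skew[of a z] odd_commute[of z v]
    by (auto simp: center_def)
  then show "y \<cdot> z = 0" using y center_odd[OF assms(1)] by simp
qed

lemma center_zero: "0 \<in> center g"
  and center_add: "\<lbrakk>y \<in> center g; z \<in> center g\<rbrakk> \<Longrightarrow> y + z \<in> center g"
  and center_scale: "z \<in> center g \<Longrightarrow> c \<odot> z \<in> center g"
  by (simp_all add: center_def)

text \<open>If all vectors orthogonal to \<open>a\<close> were isotropic, polarisation would make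
  them orthogonal to each other, hence elements of the radical of \<open>F\<close>. Then
  \<open>L\<close> would be the line of \<open>a\<close> and abelian. Here \<open>p\<close> is the
  projection along \<open>a\<close> onto the orthogonal complement.\<close>

lemma orthogonal_nonisotropic:
  assumes a: "a \<in> L" "F a a \<noteq> 0" shows "\<exists>b\<in>L. F a b = 0 \<and> F b b \<noteq> 0"
proof (rule ccontr)
  assume "\<not> (\<exists>b\<in>L. F a b = 0 \<and> F b b \<noteq> 0)"
  then have iso: "F b b = 0" if "b \<in> L" "F a b = 0" for b using that by blast
  have mult: "b = (F a b / F a a) \<odot> a" if b: "b \<in> L" for b
  proof -
    define p where "p r = r - (F a r / F a a) \<odot> a" for r
    have p: "p r \<in> L" "F a (p r) = 0" if "r \<in> L" for r using that a by (simp_all add: p_def)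
    have pp: "F (p b) (p r) = 0" if "r \<in> L" for r
    proof -
      have "F (p b + p r) (p b + p r) = 0" using p b that by (intro iso) simp_all
      then have "2 * F (p b) (p r) = 0"
        using p b that iso[of "p b"] iso[of "p r"] F_sym[of "p r" "p b"] by simp
      then show ?thesis by simp
    qed
    have "F (p b) r = 0" if r: "r \<in> L" for r
    proof -
      have "F (p b) a = 0" using p(2)[OF b] by (simp add: F_sym[of _ a])
      then have "F (p b) ((F a r / F a a) \<odot> a + p r) = 0" using pp[OF r] p r a by simp
      then show ?thesis by (simp add: p_def)
    qed
    then have "p b = 0" using p b by (intro F_nondegenerate) auto
    then show ?thesis by (simp add: p_def)
  qed
  have "b \<cdot> r = 0" if br: "b \<in> L" "r \<in> L" for b r
    by (subst mult[OF br(1)], subst mult[OF br(2)]) (use a in \<open>simp add: even_brk_self\<close>)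
  then show False using nonabelian by blast
qed

text \<open>Subtracting a multiple of the isotropic \<open>a\<close> changes the norm of
  \<open>s\<close> linearly, so it can be made 0. The value 2 is the normalisation for which
  \<open>a\<close>, \<open>b\<close> and their bracket satisfy the standard
  \<open>sl\<^sub>2\<close> relations.\<close>

lemma isotropic_partner:
  assumes a: "a \<in> L" "a \<noteq> 0" "F a a = 0" obtains b where "b \<in> L" "F b b = 0" "F a b = 2"
proof -
  obtain r where r: "r \<in> L" "F a r \<noteq> 0" using F_nondegenerate a by blast
  define s where "s = (2 / F a r) \<odot> r"
  have s: "s \<in> L" "F a s = 2" using r by (simp_all add: s_def)
  have "F (s - (F s s / 4) \<odot> a) (s - (F s s / 4) \<odot> a) = 0"
    using a s F_sym[of s a] by (simp add: field_simps)
  then show ?thesis using s a by (intro that[of "s - (F s s / 4) \<odot> a"]) simp_all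
qed

text \<open>
  Polarisation of a quartic form: its restriction to a line is a polynomial in \<open>t\<close> without
  constant or leading term, and is evaluated at \<open>t = 1, -1, 2\<close>.
\<close>

lemma isotropic_polarise:
  assumes iso: "\<And>y. y \<in> V \<Longrightarrow> F (y \<cdot> y) (y \<cdot> y) = 0" and y: "y \<in> V" and z: "z \<in> V"
  shows "F (y \<cdot> y) (y \<cdot> z) = 0"
proof -
  define P R S where PRS: "P = y \<cdot> y" "R = y \<cdot> z" "S = z \<cdot> z"
  define k where "k = 2 * F P S + 4 * F R R"
  have L: "P \<in> L" "R \<in> L" "S \<in> L" using y z by (simp_all add: PRS)
  have 0: "F P P = 0" "F S S = 0" using iso y z by (simp_all add: PRS)
  have *: "4 * t * F P R + t^2 * k + 4 * t^3 * F R S = 0" for t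
  proof -
    have t2: "(2 * t) \<odot> r = t \<odot> r + t \<odot> r" for r by (simp flip: vs.scale_left_distrib)
    have "(y + t \<odot> z) \<cdot> (y + t \<odot> z) = P + (2 * t) \<odot> R + (t * t) \<odot> S"
      using y z odd_commute[of z y] by (simp add: PRS t2 vs.scale_right_distrib)
    then have "F (P + (2 * t) \<odot> R + (t * t) \<odot> S) (P + (2 * t) \<odot> R + (t * t) \<odot> S) = 0"
      using iso[of "y + t \<odot> z"] y z by simp
    then show ?thesis
      using L 0 F_sym[of R P] F_sym[of S P] F_sym[of S R]
      by (simp add: k_def power2_eq_square power3_eq_cube algebra_simps)
  qed
  define \<alpha> \<beta> where "\<alpha> = F P R" "\<beta> = F R S"
  have 1: "4 * \<alpha> + k + 4 * \<beta> = 0" "- 4 * \<alpha> + k - 4 * \<beta> = 0" "8 * \<alpha> + 4 * k + 32 * \<beta> = 0"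
    using *[of 1] *[of "-1"] *[of 2] by (simp_all add: \<alpha>_\<beta>_def)
  \<comment> \<open>This combination of the three evaluations eliminates both \<open>k\<close> and
    \<open>\<beta>\<close>.\<close>
  have "12 * (2 * \<alpha>) =
    6 * (4 * \<alpha> + k + 4 * \<beta>) - 2 * (- 4 * \<alpha> + k - 4 * \<beta>) - (8 * \<alpha> + 4 * k + 32 * \<beta>)"
    by (simp add: algebra_simps)
  then have "12 * (2 * \<alpha>) = 0" unfolding 1 by simp
  then have "2 * \<alpha> = 0" using numerals_nonzero(3) mult_eq_0_iff by blast
  then show ?thesis by (simp add: \<alpha>_\<beta>_def PRS)
qed

lemma square_nonzero:
  assumes "y \<in> V" "z \<in> V" "y \<cdot> z \<noteq> 0" shows "\<exists>x\<in>V. x \<cdot> x \<noteq> 0"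
proof (rule ccontr)
  assume "\<not> (\<exists>x\<in>V. x \<cdot> x \<noteq> 0)"
  then have 0: "x \<cdot> x = 0" if "x \<in> V" for x using that by blast
  have "(y + z) \<cdot> (y + z) = 0" using assms by (intro 0) simp
  then have "y \<cdot> z + y \<cdot> z = 0" using assms odd_commute[of z y] by (simp add: 0[OF assms(1)] 0[OF assms(2)])
  then show False using assms(3) double_eq_0 by blast
qed

end

section \<open>An odd element with non-isotropic square\<close>

text \<open>The square of \<open>x\<close>, the vector \<open>p\<close> and their bracket will form
  an orthogonal basis of \<open>L\<close>.\<close>

locale semisimple_square = cross_product_superalgebra +
  fixes x p
  assumes x [simp]: "x \<in> V" and p [simp]: "p \<in> L"
    and square_nonisotropic: "F (x \<cdot> x) (x \<cdot> x) \<noteq> 0"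
    and p_orth: "F (x \<cdot> x) p = 0"
    and p_nonisotropic: "F p p \<noteq> 0"
begin

definition H where "H = x \<cdot> x"
definition q where "q = H \<cdot> p"
definition \<kappa> where "\<kappa> = F H H"
definition \<delta> where "\<delta> = F p p"
definition u where "u = p \<cdot> x"
definition w where "w = q \<cdot> x"
text \<open>Acting twice by \<open>p\<close> kills the invariant part of \<open>x\<close> and, in
  the adjoint representation, multiplies \<open>H\<close> by \<open>\<delta>\<close>. Dividing by
  \<open>\<delta>\<close> isolates the component of \<open>x\<close> that is to correspond to
  \<open>H\<close>.\<close>

definition h where "h = (1 / \<delta>) \<odot> (p \<cdot> u)"
definition t where "t = x - h"

lemma nonzero [simp]: "\<kappa> \<noteq> 0" "\<delta> \<noteq> 0" "H \<noteq> 0"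
  using square_nonisotropic p_nonisotropic F_scale[of 0 0 H]
  by (auto simp: \<kappa>_def \<delta>_def H_def)

lemma closed [simp]: "H \<in> L" "q \<in> L" "u \<in> V" "w \<in> V" "h \<in> V" "t \<in> V"
  by (simp_all add: H_def q_def u_def w_def h_def t_def)

lemma brk_basis [simp]:
  "H \<cdot> p = q" "p \<cdot> H = - q" "H \<cdot> q = \<kappa> \<odot> p" "q \<cdot> H = - (\<kappa> \<odot> p)"
  "p \<cdot> q = - (\<delta> \<odot> H)" "q \<cdot> p = \<delta> \<odot> H" "H \<cdot> H = 0" "p \<cdot> p = 0" "q \<cdot> q = 0"
proof -
  show Hp: "H \<cdot> p = q" by (simp add: q_def)
  then show pH: "p \<cdot> H = - q" using even_skew[of H p] by simp
  show Hq: "H \<cdot> q = \<kappa> \<odot> p" using F_cross[of H H p] p_orth by (simp add: q_def \<kappa>_def H_def)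
  then show "q \<cdot> H = - (\<kappa> \<odot> p)" using even_skew[of H q] by simp
  show pq: "p \<cdot> q = - (\<delta> \<odot> H)"
    using F_cross[of p H p] p_orth F_sym[of p H] by (simp add: q_def \<delta>_def H_def)
  then show "q \<cdot> p = \<delta> \<odot> H" using even_skew[of p q] by simp
qed (simp_all add: even_brk_self)

lemma q_nonzero [simp]: "p \<noteq> 0" "q \<noteq> 0"
proof -
  show "p \<noteq> 0" using p_nonisotropic F_scale[of 0 0 p] by auto
  then have "H \<cdot> q \<noteq> H \<cdot> 0" by simp
  then show "q \<noteq> 0" by metis
qed

lemma F_basis [simp]: "F H H = \<kappa>" "F p p = \<delta>" "F H p = 0" "F p H = 0" "F H q = 0" "F q H = 0"
  "F p q = 0" "F q p = 0"
proof -
  show "F H H = \<kappa>" "F p p = \<delta>" "F H p = 0" "F p H = 0"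
    using p_orth by (simp_all add: \<kappa>_def \<delta>_def H_def F_sym[of p "x \<cdot> x"])
  show "F H q = 0" "F p q = 0" using F_brk_self[of H p] F_brk_self[of p H] by simp_all
  then show "F q H = 0" "F q p = 0" by (simp_all add: F_sym[of q])
qed

text \<open>After removal of the projections to \<open>H\<close> and \<open>p\<close>, the remainder
  commutes with \<open>q = H \<cdot> p\<close> by the cross product identity, so
  \<open>centralizer\<close> applies.\<close>

lemma basis_expand:
  assumes "a \<in> L" obtains \<alpha> \<beta> \<gamma> where "a = \<alpha> \<odot> H + \<beta> \<odot> p + \<gamma> \<odot> q"
proof -
  define a' where "a' = a - (F a H / \<kappa>) \<odot> H - (F a p / \<delta>) \<odot> p"
  have a' [simp]: "a' \<in> L" using assms by (simp add: a'_def)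
  have "F a' H = 0" "F a' p = 0" using assms by (simp_all add: a'_def)
  then have "a' \<cdot> (H \<cdot> p) = 0" by (subst F_cross) simp_all
  then have "q \<cdot> a' = 0" using even_skew[of a' q] by simp
  then obtain \<gamma> where "a' = \<gamma> \<odot> q" using centralizer[of q a'] by auto
  then have "a = (F a H / \<kappa>) \<odot> H + (F a p / \<delta>) \<odot> p + \<gamma> \<odot> q"
    by (simp add: a'_def algebra_simps)
  then show ?thesis by (rule that)
qed

lemma basis_independent:
  assumes "\<alpha> \<odot> H + \<beta> \<odot> p + \<gamma> \<odot> q = 0" shows "\<alpha> = 0" "\<beta> = 0" "\<gamma> = 0"
proof -
  have F0: "F 0 e = 0" for e using F_scale[of 0 0 e] by simp
  have "F (\<alpha> \<odot> H + \<beta> \<odot> p + \<gamma> \<odot> q) H = 0" "F (\<alpha> \<odot> H + \<beta> \<odot> p + \<gamma> \<odot> q) p = 0"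
    unfolding assms by (simp_all add: F0)
  then show "\<alpha> = 0" "\<beta> = 0" by simp_all
  then show "\<gamma> = 0" using assms by simp
qed

lemma act_order:
  assumes "z \<in> C"
  shows "H \<cdot> p \<cdot> z = q \<cdot> z + p \<cdot> H \<cdot> z" "H \<cdot> q \<cdot> z = \<kappa> \<odot> (p \<cdot> z) + q \<cdot> H \<cdot> z"
    "p \<cdot> q \<cdot> z = q \<cdot> p \<cdot> z - \<delta> \<odot> (H \<cdot> z)"
  using leibniz[of H p z] leibniz[of H q z] leibniz[of p q z] assms by simp_all

text \<open>By \<open>square_act\<close>, \<open>H \<cdot> z\<close> has the form
  \<open>a \<cdot> x\<close> with \<open>a\<close> even. Since \<open>H \<cdot> x = 0\<close>,
  \<open>H\<close> acts on such vectors through its bracket with \<open>a\<close>, whose square is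
  \<open>\<kappa>\<close> up to a multiple of \<open>H\<close>, and that multiple kills
  \<open>x\<close>.\<close>

lemma cubic:
  assumes [simp]: "z \<in> V" shows "H \<cdot> H \<cdot> H \<cdot> z = \<kappa> \<odot> (H \<cdot> z)"
proof -
  define \<phi> where "\<phi> = x \<cdot> z"
  have [simp]: "\<phi> \<in> L" by (simp add: \<phi>_def)
  have Hx: "H \<cdot> x = 0" using square_act_self[OF x] by (simp add: H_def)
  have *: "H \<cdot> (a \<cdot> x) = (H \<cdot> a) \<cdot> x" if "a \<in> L" for a
    using leibniz[of H a x] that Hx by simp
  have Hz: "H \<cdot> z = - (2 \<odot> (\<phi> \<cdot> x))"
    using square_act[OF x \<open>z \<in> V\<close>] by (simp add: H_def \<phi>_def)
  have "H \<cdot> H \<cdot> \<phi> = \<kappa> \<odot> \<phi> - F H \<phi> \<odot> H" using F_cross[of H H \<phi>] by simp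
  then have "H \<cdot> H \<cdot> H \<cdot> z = - (2 \<odot> ((\<kappa> \<odot> \<phi> - F H \<phi> \<odot> H) \<cdot> x))"
    unfolding Hz by (simp add: *)
  also have "\<dots> = \<kappa> \<odot> (H \<cdot> z)"
    unfolding Hz by (simp add: Hx mult.commute)
  finally show ?thesis .
qed

text \<open>
  Since \<open>H \<cdot> x = 0\<close>, the operators \<open>p\<close> and \<open>q\<close> commute on \<open>x\<close>. This gives
  \<open>H\<^sup>2 (p \<cdot> w) = 4 \<kappa> (p \<cdot> w)\<close>, which is incompatible with the cubic unless \<open>p \<cdot> w = 0\<close>.
\<close>

lemma second_order: "H \<cdot> u = w" "H \<cdot> w = \<kappa> \<odot> u" "p \<cdot> w = 0" "q \<cdot> u = 0" "q \<cdot> w = - (\<kappa> \<odot> (p \<cdot> u))"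
proof -
  have Hx: "H \<cdot> x = 0" using square_act_self[OF x] by (simp add: H_def)
  show Hu: "H \<cdot> u = w" and Hw: "H \<cdot> w = \<kappa> \<odot> u"
    using act_order[of x] Hx by (simp_all add: u_def w_def)
  have qu: "q \<cdot> u = p \<cdot> w" using act_order(3)[of x] Hx by (simp add: u_def w_def)
  have 1: "H \<cdot> p \<cdot> u = 2 \<odot> (p \<cdot> w)"
    using act_order(1)[of u] by (simp add: Hu qu scale_two)
  have 2: "H \<cdot> p \<cdot> w = q \<cdot> w + \<kappa> \<odot> (p \<cdot> u)"
    using act_order(1)[of w] by (simp add: Hw)
  have 3: "H \<cdot> q \<cdot> w = (2 * \<kappa>) \<odot> (p \<cdot> w)"
    using act_order(2)[of w] by (simp add: Hw qu scale_two flip: vs.scale_scale)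
  \<comment> \<open>The relations \<open>1\<close>, \<open>2\<close>, \<open>3\<close> give the
    factor \<open>8 * \<kappa>\<close>, while \<open>cubic\<close> gives
    \<open>2 * \<kappa>\<close>; the difference is invertible.\<close>
  have "H \<cdot> H \<cdot> H \<cdot> p \<cdot> u = (8 * \<kappa>) \<odot> (p \<cdot> w)"
    by (simp add: 1 2 3 flip: vs.scale_left_distrib)
  moreover have "H \<cdot> H \<cdot> H \<cdot> p \<cdot> u = (2 * \<kappa>) \<odot> (p \<cdot> w)"
    using cubic[of "p \<cdot> u"] by (simp add: 1)
  moreover have "6 * \<kappa> = 8 * \<kappa> - 2 * \<kappa>" by simp
  ultimately have "(6 * \<kappa>) \<odot> (p \<cdot> w) = 0"
    by (metis vs.scale_left_diff_distrib right_minus_eq)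
  then show pw: "p \<cdot> w = 0" by simp
  then show "q \<cdot> u = 0" using qu by simp
  show "q \<cdot> w = - (\<kappa> \<odot> (p \<cdot> u))" using 2 pw by (simp add: eq_neg_iff_add_eq_0)
qed

text \<open>These are the relations of the adjoint representation, with \<open>h\<close>,
  \<open>u\<close>, \<open>w\<close> in the places of \<open>H\<close>, \<open>- q\<close> and
  \<open>- (\<kappa> \<odot> p)\<close>.\<close>

lemma adjoint_action [simp]:
  "H \<cdot> h = 0" "p \<cdot> h = u" "q \<cdot> h = w"
  "H \<cdot> u = w" "p \<cdot> u = \<delta> \<odot> h" "q \<cdot> u = 0"
  "H \<cdot> w = \<kappa> \<odot> u" "p \<cdot> w = 0" "q \<cdot> w = - ((\<kappa> * \<delta>) \<odot> h)"
proof -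
  note s = second_order
  show "H \<cdot> u = w" "H \<cdot> w = \<kappa> \<odot> u" "p \<cdot> w = 0" "q \<cdot> u = 0" by (fact s)+
  show pu: "p \<cdot> u = \<delta> \<odot> h" by (simp add: h_def)
  show qw: "q \<cdot> w = - ((\<kappa> * \<delta>) \<odot> h)" using s(5) pu by simp
  have "\<delta> \<odot> (H \<cdot> h) = 0" using act_order(1)[of u] by (simp add: s pu)
  then show "H \<cdot> h = 0" by simp
  have "\<delta> \<odot> (q \<cdot> h) = \<delta> \<odot> w" using act_order(3)[of u] by (simp add: s pu)
  then show "q \<cdot> h = w" by simp
  have "(\<kappa> * \<delta>) \<odot> (p \<cdot> h) = (\<kappa> * \<delta>) \<odot> u" using act_order(3)[of w] s(1-4) pu qw by simp
  then show "p \<cdot> h = u" by simp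
qed

lemma act_0I:
  assumes "z \<in> C" "H \<cdot> z = 0" "p \<cdot> z = 0" "q \<cdot> z = 0" "a \<in> L" shows "a \<cdot> z = 0"
proof -
  obtain \<alpha> \<beta> \<gamma> where a: "a = \<alpha> \<odot> H + \<beta> \<odot> p + \<gamma> \<odot> q" using \<open>a \<in> L\<close> by (rule basis_expand)
  show ?thesis unfolding a using assms(1-4) by simp
qed

text \<open>The vectors \<open>x\<close> and \<open>h\<close> have the same images under
  \<open>H\<close>, \<open>p\<close> and \<open>q\<close>, namely 0, \<open>u\<close> and
  \<open>w\<close>.\<close>

lemma t_invariant: "a \<in> L \<Longrightarrow> a \<cdot> t = 0"
proof (rule act_0I)
  show "H \<cdot> t = 0" using square_act_self[OF x] by (simp add: t_def flip: H_def)
qed (simp_all add: t_def flip: u_def w_def)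

lemma x_split: "x = h + t" by (simp add: t_def)

lemma tt: "t \<cdot> t = 0"
  by (rule invariant_pair) (simp_all add: t_invariant)

text \<open>Since \<open>H\<close> kills \<open>h\<close>, the square of \<open>h\<close> is a
  multiple \<open>a \<odot> H\<close>. Acting by \<open>p\<close> twice expresses
  \<open>h \<cdot> u\<close> and \<open>u \<cdot> u\<close> through \<open>a\<close>; as
  \<open>q\<close> kills \<open>u\<close>, it must kill \<open>u \<cdot> u\<close>, a multiple of
  \<open>H\<close> that vanishes only for \<open>a = 0\<close>.\<close>

lemma hh: "h \<cdot> h = 0"
proof -
  have comm: "u \<cdot> h = h \<cdot> u" by (rule odd_commute) simp_all
  have "H \<cdot> (h \<cdot> h) = 0" using square_leibniz[of H h] by simp
  then obtain a where hh: "h \<cdot> h = a \<odot> H" using centralizer[of H "h \<cdot> h"] by auto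
  have "2 \<odot> (h \<cdot> u) = - (a \<odot> q)" using square_leibniz[of p h] by (simp add: hh comm)
  then have "(1/2) \<odot> (2 \<odot> (h \<cdot> u)) = (1/2) \<odot> - (a \<odot> q)" by simp
  then have hu: "h \<cdot> u = - ((a / 2) \<odot> q)" by simp
  have "(a / 2 * \<delta>) \<odot> H = u \<cdot> u + (\<delta> * a) \<odot> H"
    using leibniz[of p h u] by (simp add: hu hh)
  then have uu: "u \<cdot> u = (a / 2 * \<delta> - \<delta> * a) \<odot> H"
    by (simp add: vs.scale_left_diff_distrib eq_diff_eq)
  have "q \<cdot> (u \<cdot> u) = 0" using square_leibniz[of q u] by simp
  then have "(a / 2 * \<delta> - \<delta> * a) * \<kappa> = 0" by (simp add: uu del: mult_eq_0_iff)
  moreover have "a * \<delta> * \<kappa> = - 2 * ((a / 2 * \<delta> - \<delta> * a) * \<kappa>)" by (simp add: field_simps)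
  ultimately have "a * \<delta> * \<kappa> = 0" by (simp only: mult_zero_right)
  then have "a = 0" by simp
  then show ?thesis using hh by simp
qed

text \<open>Only the mixed terms survive when the square of \<open>h + t\<close> is
  expanded.\<close>

lemma ht: "2 \<odot> (t \<cdot> h) = H" "2 \<odot> (h \<cdot> t) = H"
proof -
  have "H = (h + t) \<cdot> (h + t)" using x_split by (simp add: H_def)
  then show "2 \<odot> (t \<cdot> h) = H" "2 \<odot> (h \<cdot> t) = H"
    using odd_commute[of h t] by (simp_all add: hh tt scale_two)
qed

text \<open>
  The equivariant map \<open>\<psi>\<close> identifies \<open>U\<close> with the adjoint representation, with inverse \<open>\<theta>\<close>, and its
  kernel \<open>M\<close> is a complement of \<open>U\<close> on which the even part acts trivially.
\<close>

definition U where "U = {\<alpha> \<odot> h + \<beta> \<odot> u + \<gamma> \<odot> w | \<alpha> \<beta> \<gamma>. True}"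
definition \<psi> where "\<psi> z = 2 \<odot> (t \<cdot> z)"
definition M where "M = {z \<in> V. \<psi> z = 0}"

lemma U_V: "z \<in> U \<Longrightarrow> z \<in> V" by (auto simp: U_def)

lemma psi_linear [simp]:
  "\<lbrakk>y \<in> C; z \<in> C\<rbrakk> \<Longrightarrow> \<psi> (y + z) = \<psi> y + \<psi> z"
  "\<lbrakk>y \<in> C; z \<in> C\<rbrakk> \<Longrightarrow> \<psi> (y - z) = \<psi> y - \<psi> z"
  "z \<in> C \<Longrightarrow> \<psi> (c \<odot> z) = c \<odot> \<psi> z"
  by (simp_all add: \<psi>_def vs.scale_right_distrib vs.scale_right_diff_distrib mult.commute)

lemma psi_closed [simp]: "z \<in> V \<Longrightarrow> \<psi> z \<in> L"
  by (simp add: \<psi>_def)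

lemma psi_equivariant: "\<lbrakk>a \<in> L; z \<in> V\<rbrakk> \<Longrightarrow> \<psi> (a \<cdot> z) = a \<cdot> \<psi> z"
  using leibniz[of a t z] by (simp add: \<psi>_def t_invariant)

text \<open>The factor 2 in \<open>\<psi>\<close> is chosen to give \<open>H\<close> at
  \<open>h\<close>; equivariance then determines the values at \<open>u\<close> and
  \<open>w\<close>.\<close>

lemma psi_basis [simp]: "\<psi> h = H" "\<psi> u = - q" "\<psi> w = - (\<kappa> \<odot> p)" "\<psi> t = 0"
proof -
  show h: "\<psi> h = H" by (simp add: \<psi>_def ht)
  show "\<psi> u = - q" using psi_equivariant[of p h] h by simp
  show "\<psi> w = - (\<kappa> \<odot> p)" using psi_equivariant[of q h] h by simp
  show "\<psi> t = 0" by (simp add: \<psi>_def tt)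
qed

lemma U_subspace: "vs.subspace U"
proof -
  have "U = vs.span {h, u, w}" unfolding U_def using vs.span_triple[of _ h u w] by auto
  then show ?thesis by simp
qed

lemma U_closed:
  assumes "a \<in> L" "z \<in> U" shows "a \<cdot> z \<in> U"
proof -
  have b: "h \<in> U" "u \<in> U" "w \<in> U" "0 \<in> U"
    unfolding U_def by (force intro: exI[of _ 0] exI[of _ 1])+
  note s = vs.subspace_add[OF U_subspace] vs.subspace_scale[OF U_subspace] vs.subspace_neg[OF U_subspace]
    vs.subspace_diff[OF U_subspace]
  obtain \<alpha> \<beta> \<gamma> where a: "a = \<alpha> \<odot> H + \<beta> \<odot> p + \<gamma> \<odot> q" using assms(1) by (rule basis_expand)
  obtain \<alpha>' \<beta>' \<gamma>' where z: "z = \<alpha>' \<odot> h + \<beta>' \<odot> u + \<gamma>' \<odot> w" using assms(2) by (auto simp: U_def)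
  show ?thesis unfolding a z by (simp add: s b)
qed

lemma psi_inj:
  assumes "z \<in> U" "\<psi> z = 0" shows "z = 0"
proof -
  obtain \<alpha> \<beta> \<gamma> where z: "z = \<alpha> \<odot> h + \<beta> \<odot> u + \<gamma> \<odot> w" using assms(1) by (auto simp: U_def)
  then have "\<alpha> \<odot> H + (- \<gamma> * \<kappa>) \<odot> p + (- \<beta>) \<odot> q = 0" using assms(2) by (simp add: algebra_simps)
  from basis_independent[OF this] show ?thesis unfolding z by simp
qed

lemma psi_surj:
  assumes "a \<in> L" shows "\<exists>z\<in>U. \<psi> z = a"
proof -
  obtain \<alpha> \<beta> \<gamma> where a: "a = \<alpha> \<odot> H + \<beta> \<odot> p + \<gamma> \<odot> q" using assms by (rule basis_expand)
  let ?z = "\<alpha> \<odot> h + (- \<gamma>) \<odot> u + (- \<beta> / \<kappa>) \<odot> w"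
  have "\<psi> ?z = a" by (simp add: a)
  moreover have "?z \<in> U" unfolding U_def by blast
  ultimately show ?thesis by blast
qed

definition \<theta> where "\<theta> a = (SOME z. z \<in> U \<and> \<psi> z = a)"

lemma theta: assumes "a \<in> L" shows "\<theta> a \<in> U" "\<psi> (\<theta> a) = a" "\<theta> a \<in> V"
proof -
  have "\<theta> a \<in> U \<and> \<psi> (\<theta> a) = a"
    unfolding \<theta>_def by (rule someI_ex) (use psi_surj[OF assms] in blast)
  then show "\<theta> a \<in> U" "\<psi> (\<theta> a) = a" "\<theta> a \<in> V" using U_V by auto
qed

text \<open>Injectivity of \<open>\<psi>\<close> on \<open>U\<close> makes the choice in
  \<open>\<theta>\<close> unique; linearity and equivariance of \<open>\<theta>\<close> follow from
  this.\<close>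

lemma theta_eqI: assumes "z \<in> U" "\<psi> z = a" "a \<in> L" shows "\<theta> a = z"
proof -
  have "\<theta> a - z = 0"
    by (rule psi_inj)
      (use assms theta[of a] vs.subspace_diff[OF U_subspace] U_V[OF assms(1)] in simp_all)
  then show ?thesis by simp
qed

lemma theta_linear:
  "\<lbrakk>a \<in> L; b \<in> L\<rbrakk> \<Longrightarrow> \<theta> (a + b) = \<theta> a + \<theta> b"
  "a \<in> L \<Longrightarrow> \<theta> (r \<odot> a) = r \<odot> \<theta> a"
  "\<lbrakk>a \<in> L; b \<in> L\<rbrakk> \<Longrightarrow> \<theta> (a \<cdot> b) = a \<cdot> \<theta> b"
  by (auto intro!: theta_eqI vs.subspace_add[OF U_subspace] vs.subspace_scale[OF U_subspace] U_closed
      simp: theta psi_equivariant)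

text \<open>All brackets between basis vectors arise from \<open>h \<cdot> h = 0\<close> by acting
  with \<open>p\<close> and \<open>q\<close>.\<close>

lemma UU: assumes "y \<in> U" "z \<in> U" shows "y \<cdot> z = 0"
proof -
  have c: "u \<cdot> h = h \<cdot> u" "w \<cdot> h = h \<cdot> w" "w \<cdot> u = u \<cdot> w" by (simp_all add: odd_commute)
  have "2 \<odot> (u \<cdot> h) = 0" "2 \<odot> (w \<cdot> h) = 0"
    using square_leibniz[of p h] square_leibniz[of q h] by (simp_all add: hh)
  then have hu: "h \<cdot> u = 0" and hw: "h \<cdot> w = 0" by (simp_all add: c)
  have uu: "u \<cdot> u = 0" using leibniz[of p h u] by (simp add: hu hh)
  have uw: "u \<cdot> w = 0" using leibniz[of p h w] by (simp add: hw)
  have ww: "w \<cdot> w = 0" using leibniz[of q h w] by (simp add: hw hh)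
  obtain \<alpha> \<beta> \<gamma> where y: "y = \<alpha> \<odot> h + \<beta> \<odot> u + \<gamma> \<odot> w" using assms(1) by (auto simp: U_def)
  obtain \<alpha>' \<beta>' \<gamma>' where z: "z = \<alpha>' \<odot> h + \<beta>' \<odot> u + \<gamma>' \<odot> w" using assms(2) by (auto simp: U_def)
  show ?thesis unfolding y z by (simp add: c hh hu hw uu uw ww)
qed

section \<open>The kernel of \<open>\<psi>\<close> and the center\<close>

lemma M_V: "m \<in> M \<Longrightarrow> m \<in> V" by (simp add: M_def)

lemma M_closed: "\<lbrakk>a \<in> L; m \<in> M\<rbrakk> \<Longrightarrow> a \<cdot> m \<in> M"
  by (simp add: M_def psi_equivariant)

text \<open>As \<open>h \<cdot> h = 0\<close>, \<open>square_act\<close> gives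
  \<open>(h \<cdot> m) \<cdot> h = 0\<close>, and \<open>\<psi>\<close> turns this into
  \<open>h \<cdot> m\<close> commuting with \<open>H\<close>. Because
  \<open>t \<cdot> m = 0\<close>, also \<open>x \<cdot> m\<close> is a multiple of \<open>H\<close>,
  which kills \<open>x\<close>; so \<open>square_act\<close> for \<open>x\<close> yields
  \<open>H \<cdot> m = 0\<close>.\<close>

lemma h_brk_M:
  assumes "m \<in> M" obtains \<mu> where "h \<cdot> m = \<mu> \<odot> H" "H \<cdot> m = 0"
proof -
  have m [simp]: "m \<in> V" using assms by (simp add: M_def)
  have tm: "t \<cdot> m = 0" using assms by (simp add: M_def \<psi>_def)
  have "(h \<cdot> m) \<cdot> h = 0" using square_act[of h m] by (simp add: hh)
  then have "(h \<cdot> m) \<cdot> H = 0" using psi_equivariant[of "h \<cdot> m" h] by (simp add: \<psi>_def[of 0])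
  then have "H \<cdot> (h \<cdot> m) = 0" using even_skew[of H "h \<cdot> m"] by simp
  then obtain \<mu> where \<mu>: "h \<cdot> m = \<mu> \<odot> H" using centralizer[of H "h \<cdot> m"] by auto
  have "(h + t) \<cdot> m = \<mu> \<odot> H" using tm \<mu> by simp
  then have "x \<cdot> m = \<mu> \<odot> H" by (simp flip: x_split)
  moreover have "H \<cdot> x = 0" using square_act_self[OF x] by (simp add: H_def)
  ultimately have "H \<cdot> m = 0" using square_act[of x m] by (simp flip: H_def)
  with \<mu> show ?thesis by (rule that)
qed

text \<open>\<open>H\<close> kills the submodule \<open>M\<close>, and \<open>q\<close> and
  \<open>\<kappa> \<odot> p\<close> act as commutators with \<open>H\<close>.\<close>

lemma M_invariant: assumes "m \<in> M" "a \<in> L" shows "a \<cdot> m = 0"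
proof -
  have m [simp]: "m \<in> V" using assms by (simp add: M_def)
  have *: "H \<cdot> y = 0" if "y \<in> M" for y using h_brk_M[OF that] by blast
  show ?thesis
  proof (rule act_0I[OF _ *[OF assms(1)] _ _ assms(2)])
    show "q \<cdot> m = 0" using act_order(1)[of m] *[OF assms(1)] *[OF M_closed[of p]] assms by simp
    show "p \<cdot> m = 0" using act_order(2)[of m] *[OF assms(1)] *[OF M_closed[of q]] assms by simp
  qed simp
qed

lemma MM: "\<lbrakk>y \<in> M; z \<in> M\<rbrakk> \<Longrightarrow> y \<cdot> z = 0"
  by (rule invariant_pair) (simp_all add: M_V M_invariant)

text \<open>Bracketing with the invariant \<open>m\<close> is an equivariant map from
  \<open>U\<close> to \<open>L\<close>, so its value at the generator \<open>h\<close> determines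
  it.\<close>

lemma U_brk_M:
  assumes "m \<in> M" obtains \<mu> where "\<And>y. y \<in> U \<Longrightarrow> y \<cdot> m = \<mu> \<odot> \<psi> y" "h \<cdot> m = \<mu> \<odot> H"
proof -
  have m [simp]: "m \<in> V" using assms by (simp add: M_def)
  note inv = M_invariant[OF assms]
  obtain \<mu> where \<mu>: "h \<cdot> m = \<mu> \<odot> H" using h_brk_M[OF assms] by blast
  have u: "u \<cdot> m = \<mu> \<odot> \<psi> u" using leibniz[of p h m] by (simp add: inv \<mu>)
  have w: "w \<cdot> m = \<mu> \<odot> \<psi> w" using leibniz[of q h m] by (simp add: inv \<mu>)
  have "y \<cdot> m = \<mu> \<odot> \<psi> y" if yU: "y \<in> U" for y
  proof -
    obtain \<alpha> \<beta> \<gamma> where y: "y = \<alpha> \<odot> h + \<beta> \<odot> u + \<gamma> \<odot> w" using yU by (auto simp: U_def)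
    show ?thesis unfolding y using u w
      by (simp add: \<mu> vs.scale_right_distrib vs.scale_right_diff_distrib mult.commute mult.left_commute)
  qed
  then show ?thesis using \<mu> by (rule that)
qed

lemma V_split:
  assumes "z \<in> V" shows "z - \<theta> (\<psi> z) \<in> M"
  using assms theta[of "\<psi> z"] by (simp add: M_def)

text \<open>Any odd vector is a sum of elements of \<open>U\<close> and \<open>M\<close>.
  \<open>M\<close> brackets trivially with itself, and the bracket with \<open>U\<close> is governed
  by the scalar in \<open>h \<cdot> z\<close>.\<close>

lemma center_eq: "z \<in> center g \<longleftrightarrow> z \<in> M \<and> h \<cdot> z = 0"
proof
  assume z: "z \<in> center g"
  then show "z \<in> M \<and> h \<cdot> z = 0"
    using center_odd[OF z] center_act[OF z] by (simp add: M_def \<psi>_def)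
next
  assume z: "z \<in> M \<and> h \<cdot> z = 0"
  then obtain \<mu> where \<mu>: "\<And>y. y \<in> U \<Longrightarrow> y \<cdot> z = \<mu> \<odot> \<psi> y" "h \<cdot> z = \<mu> \<odot> H"
    using U_brk_M by blast
  then have "\<mu> = 0" using z by simp
  show "z \<in> center g"
  proof (rule centerI)
    fix y assume y [simp]: "y \<in> V"
    have [simp]: "z \<in> V" using z M_V by blast
    have [simp]: "\<theta> (\<psi> y) \<in> V" by (simp add: theta)
    have "(y - \<theta> (\<psi> y)) \<cdot> z = 0" using z V_split[OF y] by (simp add: MM del: brk_diff)
    then show "y \<cdot> z = 0" using \<mu>(1)[of "\<theta> (\<psi> y)"] \<open>\<mu> = 0\<close> by (simp add: theta)
  qed (use z M_V M_invariant in auto)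
qed

lemma adjoint_plus_trivial:
  "\<exists>\<Theta>. rep_iso L
      (rep_sum (rep_sum (bracket_rep g L) trivial_rep) (bracket_rep g (center g)))
      (bracket_rep g V) \<Theta> \<and>
    (\<forall>z\<in>center g. \<Theta> ((0, 0), z) = z) \<and>
    (\<forall>v\<in>L. \<forall>v'\<in>L. \<forall>l l'. \<forall>z\<in>center g. \<forall>z'\<in>center g.
       \<Theta> ((v, l), z) \<cdot> \<Theta> ((v', l'), z') = l' \<odot> v + l \<odot> v')"
proof -
  \<comment> \<open>The trivial summand is spanned by \<open>2 \<odot> t\<close>, so that its
    bracket with \<open>\<theta> v\<close> is exactly \<open>v\<close>.\<close>
  define t' where "t' = 2 \<odot> t"
  have t' [simp]: "t' \<in> V" "t' \<cdot> t' = 0" by (simp_all add: t'_def tt)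
  have t't: "y \<in> V \<Longrightarrow> t' \<cdot> y = \<psi> y" for y by (simp add: t'_def \<psi>_def)
  have inv: "a \<cdot> t' = 0" if "a \<in> L" for a using that by (simp add: t'_def t_invariant)
  define \<Theta> where "\<Theta> = (\<lambda>((v, l), z). \<theta> v + l \<odot> t' + z)"
  have [simp]: "\<Theta> ((v, l), z) = \<theta> v + l \<odot> t' + z" for v l z by (simp add: \<Theta>_def)
  note th [simp] = theta(2,3)
  have th0 [simp]: "\<theta> 0 = 0" using theta_linear(2)[of 0 0] by simp
  have c: "z \<in> V" "\<psi> z = 0" "h \<cdot> z = 0" if "z \<in> center g" for z
    using that by (simp_all add: center_eq M_def)
  have \<psi>t' [simp]: "\<psi> t' = 0" by (simp add: t'_def)
  have ht': "h \<cdot> t' = H" by (simp add: t'_def ht)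
  have inj: "v = v' \<and> l = l' \<and> z = z'"
    if v: "v \<in> L" "v' \<in> L" and z: "z \<in> center g" "z' \<in> center g"
      and eq: "\<theta> v + l \<odot> t' + z = \<theta> v' + l' \<odot> t' + z'" for v v' l l' z z'
  proof -
    \<comment> \<open>\<open>\<psi>\<close> reads off \<open>v\<close>; after that, the bracket with
      \<open>h\<close> reads off \<open>l\<close>.\<close>
    have "\<psi> (\<theta> v + l \<odot> t' + z) = v" "\<psi> (\<theta> v' + l' \<odot> t' + z') = v'" using v z c by simp_all
    then have vv: "v = v'" using eq by simp
    then have eq': "l \<odot> t' + z = l' \<odot> t' + z'" using eq by (simp add: add.assoc)
    have "h \<cdot> (l \<odot> t' + z) = l \<odot> H" "h \<cdot> (l' \<odot> t' + z') = l' \<odot> H" using z c ht' by simp_all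
    then have "l \<odot> H = l' \<odot> H" using eq' by simp
    then have "l = l'" by simp
    then show ?thesis using vv eq' by simp
  qed
  have surj: "\<exists>v\<in>L. \<exists>l. \<exists>z\<in>center g. y = \<theta> v + l \<odot> t' + z" if y: "y \<in> V" for y
  proof -
    define m where "m = y - \<theta> (\<psi> y)"
    have mM: "m \<in> M" using V_split[OF y] by (simp add: m_def)
    then have [simp]: "m \<in> V" by (rule M_V)
    obtain \<mu> where \<mu>: "h \<cdot> m = \<mu> \<odot> H" using h_brk_M[OF mM] by blast
    \<comment> \<open>Since \<open>h \<cdot> t' = H\<close>, subtracting
      \<open>\<mu> \<odot> t'\<close> cancels the bracket of \<open>m\<close> with \<open>h\<close>,
      which was the only obstruction to being central.\<close>
    have "m - \<mu> \<odot> t' \<in> center g"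
      using mM \<mu> by (simp add: center_eq M_def ht')
    moreover have "y = \<theta> (\<psi> y) + \<mu> \<odot> t' + (m - \<mu> \<odot> t')" by (simp add: m_def)
    ultimately show ?thesis using psi_closed[OF y] by blast
  qed
  have bij: "bij_betw \<Theta> ((L \<times> UNIV) \<times> center g) V"
    unfolding bij_betw_def
  proof
    show "inj_on \<Theta> ((L \<times> UNIV) \<times> center g)"
      by (rule inj_onI) (clarsimp, use inj in blast)
    show "\<Theta> ` ((L \<times> UNIV) \<times> center g) = V"
    proof (intro equalityI subsetI)
      fix y assume "y \<in> V"
      then obtain v l z where "v \<in> L" "z \<in> center g" "y = \<Theta> ((v, l), z)" using surj by fastforce
      then show "y \<in> \<Theta> ` ((L \<times> UNIV) \<times> center g)" by blast
    qed (auto simp: c)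
  qed
  have lin: "linear_iso_on (module_prod.scale (module_prod.scale (smul g) (*)) (smul g))
      ((L \<times> UNIV) \<times> center g) (smul g) V \<Theta>"
  proof -
    interpret tr: vector_space "(*) :: 'a \<Rightarrow> 'a \<Rightarrow> 'a" by unfold_locales (simp_all add: algebra_simps)
    interpret p1: module_prod "smul g" "(*) :: 'a \<Rightarrow> 'a \<Rightarrow> 'a" by unfold_locales
    interpret p2: module_prod p1.scale "smul g" by unfold_locales
    show ?thesis
      using bij
      by (auto simp: linear_iso_on_def p2.scale_prod p1.scale_prod theta_linear
          vs.scale_right_distrib vs.scale_left_distrib add_ac)
  qed
  have rep: "rep_iso L
      (rep_sum (rep_sum (bracket_rep g L) trivial_rep) (bracket_rep g (center g)))
      (bracket_rep g V) \<Theta>"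
    using lin center_act(1) by (auto simp: rep_iso_def rep_sum_def bracket_rep_def trivial_rep_def theta_linear inv c)
  have br: "\<Theta> ((v, l), z) \<cdot> \<Theta> ((v', l'), z') = l' \<odot> v + l \<odot> v'"
    if v: "v \<in> L" "v' \<in> L" and z: "z \<in> center g" "z' \<in> center g" for v v' l l' z z'
  proof -
    have "\<theta> v \<cdot> \<theta> v' = 0" using v by (simp add: UU theta)
    moreover have "\<theta> v \<cdot> t' = v" using v odd_commute[of "\<theta> v" t'] by (simp add: t't)
    moreover have "t' \<cdot> \<theta> v' = v'" using v by (simp add: t't)
    ultimately show ?thesis using v z c by (simp add: center_act)
  qed
  show ?thesis by (intro exI[of _ \<Theta>] conjI rep) (use br in auto)
qed

end

section \<open>Isotropic squares\<close>

text \<open>The explicit map runs from the model \<open>k\<close> to \<open>g\<close>, opposite to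
  the direction in \<open>super_iso\<close>; its inverse inherits all properties.\<close>

lemma super_iso_inverseI:
  assumes bij: "bij_betw \<Phi> (super_carrier k) (super_carrier g)"
    and homog: "\<And>\<alpha>. homog k \<alpha> \<subseteq> super_carrier k" "\<And>\<alpha>. homog g \<alpha> \<subseteq> \<Phi> ` homog k \<alpha>"
    and add: "\<And>x y. \<lbrakk>x \<in> super_carrier k; y \<in> super_carrier k\<rbrakk> \<Longrightarrow>
      x + y \<in> super_carrier k \<and> \<Phi> (x + y) = \<Phi> x + \<Phi> y"
    and scale: "\<And>c x. x \<in> super_carrier k \<Longrightarrow>
      smul k c x \<in> super_carrier k \<and> \<Phi> (smul k c x) = smul g c (\<Phi> x)"
    and brk: "\<And>x y. \<lbrakk>x \<in> super_carrier k; y \<in> super_carrier k\<rbrakk> \<Longrightarrow>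
      brk k x y \<in> super_carrier k \<and> \<Phi> (brk k x y) = brk g (\<Phi> x) (\<Phi> y)"
  shows "super_iso g k"
proof -
  define f where "f = the_inv_into (super_carrier k) \<Phi>"
  have f\<Phi> [simp]: "f (\<Phi> x) = x" if "x \<in> super_carrier k" for x
    using that bij by (auto simp: f_def bij_betw_def the_inv_into_f_f)
  have *: "\<exists>y\<in>super_carrier k. x = \<Phi> y" if "x \<in> super_carrier g" for x
    using that bij by (auto simp: bij_betw_def)
  show ?thesis
    unfolding super_iso_def linear_iso_on_def
  proof (intro exI[of _ f] conjI ballI allI)
    show "bij_betw f (super_carrier g) (super_carrier k)"
      unfolding f_def by (rule bij_betw_the_inv_into[OF bij])
    show "f (x + y) = f x + f y" if xy: "x \<in> super_carrier g" "y \<in> super_carrier g" for x y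
      using *[OF xy(1)] *[OF xy(2)] add by (metis f\<Phi>)
    show "f (smul g c x) = smul k c (f x)" if "x \<in> super_carrier g" for c x
      using *[OF that] scale by (metis f\<Phi>)
    show "f (brk g x y) = brk k (f x) (f y)" if xy: "x \<in> super_carrier g" "y \<in> super_carrier g" for x y
      using *[OF xy(1)] *[OF xy(2)] brk by (metis f\<Phi>)
    show "f ` homog g \<alpha> \<subseteq> homog k \<alpha>" for \<alpha>
    proof
      fix y assume "y \<in> f ` homog g \<alpha>"
      then obtain z where "z \<in> homog k \<alpha>" "y = f (\<Phi> z)" using homog(2) by blast
      then show "y \<in> homog k \<alpha>" using homog(1) f\<Phi> by (metis subsetD)
    qed
  qed
qed

lemma trace_2: "trace (A :: 'k::semiring_1^2^2) = A $ 1 $ 1 + A $ 2 $ 2"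
  by (simp add: trace_def sum_2)

text \<open>The factor in \<open>x \<cdot> x = 2 \<odot> e\<close> agrees with the odd bracket of
  the vector (1,0) with itself in \<open>osp12\<close>.\<close>

locale sl2_square = cross_product_superalgebra +
  fixes x e f
  assumes x [simp]: "x \<in> V" and e [simp]: "e \<in> L" and f [simp]: "f \<in> L"
    and F_ee: "F e e = 0" and F_ff: "F f f = 0" and F_ef: "F e f = 2"
    and square: "x \<cdot> x = 2 \<odot> e"
    and isotropic: "\<And>y z. \<lbrakk>y \<in> V; z \<in> V\<rbrakk> \<Longrightarrow> F (y \<cdot> y) (y \<cdot> z) = 0"
begin

section \<open>The triple \<open>e\<close>, \<open>h\<close>, \<open>f\<close> and its operators on
  the odd part\<close>

definition h where "h = e \<cdot> f"

lemma h_closed [simp]: "h \<in> L" by (simp add: h_def)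

lemma sl2_brackets [simp]:
  "e \<cdot> f = h" "f \<cdot> e = - h" "h \<cdot> e = 2 \<odot> e" "e \<cdot> h = - (2 \<odot> e)" "h \<cdot> f = - (2 \<odot> f)" "f \<cdot> h = 2 \<odot> f"
  "e \<cdot> e = 0" "f \<cdot> f = 0" "h \<cdot> h = 0"
proof -
  show ef: "e \<cdot> f = h" by (simp add: h_def)
  then show fe: "f \<cdot> e = - h" using even_skew[of e f] by simp
  show eh: "e \<cdot> h = - (2 \<odot> e)" using F_cross[of e e f] by (simp add: ef F_ee F_ef)
  then show "h \<cdot> e = 2 \<odot> e" using even_skew[of e h] by simp
  have "f \<cdot> (f \<cdot> e) = - (2 \<odot> f)" using F_cross[of f f e] by (simp add: F_ff F_ef F_sym[of f e])
  then show fh: "f \<cdot> h = 2 \<odot> f" by (simp add: fe)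
  then show "h \<cdot> f = - (2 \<odot> f)" using even_skew[of f h] by simp
qed (simp_all add: even_brk_self)

lemma F_basis [simp]: "F e e = 0" "F f f = 0" "F e f = 2" "F f e = 2" "F e h = 0" "F h e = 0" "F f h = 0" "F h f = 0"
proof -
  show "F e e = 0" "F f f = 0" "F e f = 2" "F f e = 2" using F_ee F_ff F_ef F_sym[of f e] by simp_all
  have "F e h = 0" "F f h = 0" using F_brk_self[of e f] F_brk_self[of f e] by simp_all
  then show "F e h = 0" "F h e = 0" "F f h = 0" "F h f = 0" using F_sym[of h e] F_sym[of h f] by simp_all
qed

lemma F_zero: "F 0 a = 0"
  using F_scale[of 0 0 a] by simp

lemma nonzero [simp]: "e \<noteq> 0" "f \<noteq> 0" "h \<noteq> 0"
proof -
  have "F e f \<noteq> 0" "F f e \<noteq> 0" by simp_all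
  then show e: "e \<noteq> 0" and "f \<noteq> 0" using F_zero by metis+
  have "e \<cdot> h \<noteq> e \<cdot> 0" using e by simp
  then show "h \<noteq> 0" by metis
qed

text \<open>The remainder orthogonal to \<open>e\<close> and \<open>f\<close> commutes with
  \<open>h = e \<cdot> f\<close> by the cross product identity.\<close>

lemma basis_expand:
  assumes a: "a \<in> L" obtains \<alpha> \<gamma> where "a = (F a f / 2) \<odot> e + \<gamma> \<odot> h + (F a e / 2) \<odot> f"
proof -
  define a' where "a' = a - (F a f / 2) \<odot> e - (F a e / 2) \<odot> f"
  have a' [simp]: "a' \<in> L" using assms by (simp add: a'_def)
  have "F a' e = 0" "F a' f = 0" using assms by (simp_all add: a'_def)
  then have "a' \<cdot> (e \<cdot> f) = 0" by (subst F_cross) simp_all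
  then have "h \<cdot> a' = 0" using even_skew[of a' h] by simp
  then obtain \<gamma> where "a' = \<gamma> \<odot> h" using centralizer[of h a'] by auto
  then have "a = (F a f / 2) \<odot> e + \<gamma> \<odot> h + (F a e / 2) \<odot> f"
    by (simp add: a'_def algebra_simps)
  then show ?thesis by (rule that)
qed

lemma basis_independent:
  assumes "\<alpha> \<odot> e + \<gamma> \<odot> h + \<beta> \<odot> f = 0" shows "\<alpha> = 0" "\<beta> = 0" "\<gamma> = 0"
proof -
  have "F (\<alpha> \<odot> e + \<gamma> \<odot> h + \<beta> \<odot> f) e = 0" "F (\<alpha> \<odot> e + \<gamma> \<odot> h + \<beta> \<odot> f) f = 0"
    unfolding assms by (simp_all add: F_zero)
  then show "\<alpha> = 0" "\<beta> = 0" by simp_all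
  then show "\<gamma> = 0" using assms by simp
qed

lemma act_order:
  assumes "z \<in> C"
  shows "e \<cdot> f \<cdot> z = h \<cdot> z + f \<cdot> e \<cdot> z" "h \<cdot> f \<cdot> z = f \<cdot> h \<cdot> z - 2 \<odot> (f \<cdot> z)"
    "e \<cdot> h \<cdot> z = h \<cdot> e \<cdot> z - 2 \<odot> (e \<cdot> z)"
  using leibniz[of e f z] leibniz[of h f z] leibniz[of e h z] assms by simp_all

lemma act_0I:
  assumes "z \<in> C" "e \<cdot> z = 0" "h \<cdot> z = 0" "f \<cdot> z = 0" "a \<in> L" shows "a \<cdot> z = 0"
proof -
  obtain \<gamma> where a: "a = (F a f / 2) \<odot> e + \<gamma> \<odot> h + (F a e / 2) \<odot> f"
    using \<open>a \<in> L\<close> by (rule basis_expand)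
  show ?thesis by (subst a) (use assms(1-4) in simp)
qed

text \<open>The coefficient of \<open>f\<close> is half the pairing with \<open>e\<close>, which
  vanishes by polarised isotropy.\<close>

lemma brk_no_f:
  assumes "y \<in> V" "y \<cdot> y = 2 \<odot> e" "z \<in> V"
  obtains \<alpha> \<gamma> where "y \<cdot> z = \<alpha> \<odot> e + \<gamma> \<odot> h"
proof -
  have [simp]: "y \<cdot> z \<in> L" using assms by simp
  have "F e (y \<cdot> z) = 0" using isotropic[OF assms(1,3)] assms(2) by simp
  then have "F (y \<cdot> z) e = 0" by (simp add: F_sym[of _ e])
  moreover obtain \<gamma> where "y \<cdot> z = (F (y \<cdot> z) f / 2) \<odot> e + \<gamma> \<odot> h + (F (y \<cdot> z) e / 2) \<odot> f"
    by (rule basis_expand[of "y \<cdot> z"]) simp_all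
  ultimately show ?thesis using that by simp
qed

lemma ex: "e \<cdot> x = 0"
  using square_act_self[OF x] by (simp add: square)

text \<open>In \<open>square_act\<close> only the \<open>h\<close>-part of
  \<open>x \<cdot> z\<close> acts nontrivially on \<open>x\<close>. So \<open>e\<close> has rank at
  most one on \<open>V\<close>.\<close>

lemma e_act:
  assumes z: "z \<in> V" obtains \<gamma> where "e \<cdot> z = \<gamma> \<odot> (h \<cdot> x)"
proof -
  obtain \<alpha> \<gamma> where "x \<cdot> z = \<alpha> \<odot> e + \<gamma> \<odot> h" using brk_no_f[OF x square z] .
  then have "2 \<odot> (e \<cdot> z) = 2 \<odot> ((- \<gamma>) \<odot> (h \<cdot> x))"
    using square_act[OF x z] z by (simp add: square ex)
  then have "e \<cdot> z = (- \<gamma>) \<odot> (h \<cdot> x)" by (rule vs.scale_left_imp_eq[OF two_nz])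
  then show ?thesis by (rule that)
qed

lemma ee_act: assumes z: "z \<in> V" shows "e \<cdot> e \<cdot> z = 0"
proof -
  obtain \<gamma> where "e \<cdot> z = \<gamma> \<odot> (h \<cdot> x)" using z by (rule e_act)
  then show ?thesis using act_order(3)[of x] by (simp add: ex)
qed

text \<open>Reordering \<open>e \<cdot> e \<cdot> f \<cdot> z = 0\<close> leaves twice the
  difference of the two sides.\<close>

lemma he_act: assumes [simp]: "z \<in> V" shows "h \<cdot> e \<cdot> z = e \<cdot> z"
proof -
  have "e \<cdot> e \<cdot> f \<cdot> z = 0" by (rule ee_act) simp
  then have "e \<cdot> h \<cdot> z + (h \<cdot> e \<cdot> z + f \<cdot> e \<cdot> e \<cdot> z) = 0"
    using act_order(1)[of z] act_order(1)[of "e \<cdot> z"] by simp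
  then have "2 \<odot> (h \<cdot> e \<cdot> z - e \<cdot> z) = 0"
    using act_order(3)[of z] ee_act[of z] by (simp add: scale_two algebra_simps)
  then show ?thesis by simp
qed

text \<open>This is \<open>he_act\<close> at \<open>f \<cdot> z\<close>, with \<open>e\<close> moved
  past \<open>f\<close>.\<close>

lemma hh_act: assumes [simp]: "z \<in> V" shows "h \<cdot> h \<cdot> z = h \<cdot> z + 2 \<odot> (f \<cdot> e \<cdot> z)"
proof -
  have "h \<cdot> (h \<cdot> z + f \<cdot> e \<cdot> z) = h \<cdot> z + f \<cdot> e \<cdot> z"
    using he_act[of "f \<cdot> z"] act_order(1)[of z] by simp
  then show ?thesis using act_order(2)[of "e \<cdot> z"] he_act[of z] by (simp add: scale_two algebra_simps)
qed

text \<open>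
  The relations \<open>e\<^sup>2 = 0\<close>, \<open>h e = e\<close> and \<open>h\<^sup>2 = h + 2 f e\<close> leave only the eigenvalues \<open>0\<close>, \<open>1\<close> and \<open>-1\<close> for
  \<open>h\<close>; in characteristic other than 2 and 3, vectors of any other weight vanish.
\<close>

definition x' where "x' = h \<cdot> x"
definition y' where "y' = f \<cdot> x'"

lemma xy_closed [simp]: "x' \<in> V" "y' \<in> V" by (simp_all add: x'_def y'_def)

lemma standard_action [simp]:
  "e \<cdot> x' = 0" "h \<cdot> x' = x'" "f \<cdot> x' = y'" "e \<cdot> y' = x'" "h \<cdot> y' = - y'" "f \<cdot> y' = 0"
proof -
  show ex': "e \<cdot> x' = 0" using act_order(3)[of x] by (simp add: x'_def ex)
  show hx': "h \<cdot> x' = x'" using hh_act[of x] by (simp add: x'_def ex)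
  show fx': "f \<cdot> x' = y'" by (simp add: y'_def)
  show ey': "e \<cdot> y' = x'" using act_order(1)[of x'] by (simp add: fx' ex' hx')
  show hy': "h \<cdot> y' = - y'" using act_order(2)[of x'] by (simp add: fx' hx' scale_two)
  \<comment> \<open>\<open>v\<close> has weight -3 and is killed by \<open>e\<close>, so
    \<open>hh_act\<close> would require 9 = -3 unless \<open>v\<close> vanishes.\<close>
  define v where "v = f \<cdot> y'"
  have [simp]: "v \<in> V" by (simp add: v_def)
  have hv: "h \<cdot> v = - (3 \<odot> v)"
    using act_order(2)[of y'] vs.scale_left_distrib[of 1 2 v] by (simp add: v_def hy')
  have ev: "e \<cdot> v = 0" using act_order(1)[of y'] by (simp add: v_def ey' hy' fx')
  have "9 \<odot> v = - (3 \<odot> v)" using hh_act[of v] by (simp add: hv ev)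
  then have "(9 + 3) \<odot> v = 0" unfolding vs.scale_left_distrib by simp
  then show "f \<cdot> y' = 0" by (simp add: v_def)
qed

lemma x_diff_invariant: assumes "a \<in> L" shows "a \<cdot> (x - x') = 0"
proof (rule act_0I[OF _ _ _ _ assms])
  show ex0: "e \<cdot> (x - x') = 0" by (simp add: ex)
  show hx0: "h \<cdot> (x - x') = 0" by (simp flip: x'_def)
  \<comment> \<open>Here the weight is -2, and \<open>hh_act\<close> would require 4 = -2.\<close>
  define v where "v = f \<cdot> (x - x')"
  have [simp]: "v \<in> V" by (simp add: v_def)
  have hv: "h \<cdot> v = - (2 \<odot> v)" using act_order(2)[of "x - x'"] hx0 by (simp add: v_def del: brk_diff)
  have ev: "e \<cdot> v = 0" using act_order(1)[of "x - x'"] hx0 ex0 by (simp add: v_def del: brk_diff)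
  have "4 \<odot> v = - (2 \<odot> v)" using hh_act[of v] by (simp add: hv ev)
  then have "(4 + 2) \<odot> v = 0" unfolding vs.scale_left_distrib by simp
  then show "f \<cdot> (x - x') = 0" by (simp add: v_def del: brk_diff)
qed simp

text \<open>The invariant part \<open>n\<close> of \<open>x\<close> contributes nothing to its
  square: \<open>n \<cdot> x'\<close> commutes with \<open>e\<close>, hence is a multiple of
  \<open>e\<close>, but has weight 1 whereas \<open>e\<close> has weight 2. The other brackets
  follow by acting with \<open>f\<close>.\<close>

lemma odd_brackets [simp]:
  "x' \<cdot> x' = 2 \<odot> e" "x' \<cdot> y' = - h" "y' \<cdot> x' = - h" "y' \<cdot> y' = - (2 \<odot> f)"
proof -
  define n where "n = x - x'"
  have [simp]: "n \<in> V" by (simp add: n_def)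
  have n: "a \<cdot> n = 0" if "a \<in> L" for a using x_diff_invariant[OF that] by (simp add: n_def)
  have nn: "n \<cdot> n = 0" by (rule invariant_pair) (simp_all add: n)
  have "e \<cdot> (n \<cdot> x') = 0" using leibniz[of e n x'] by (simp add: n)
  then obtain \<beta> where \<beta>: "n \<cdot> x' = \<beta> \<odot> e" using centralizer[of e "n \<cdot> x'"] by auto
  have "h \<cdot> (n \<cdot> x') = n \<cdot> x'" using leibniz[of h n x'] by (simp add: n)
  moreover have "(2::'a) \<noteq> 1" by (metis add_cancel_right_left one_add_one zero_neq_one)
  ultimately have nx: "n \<cdot> x' = 0" by (simp add: \<beta>)
  have "x \<cdot> x = (n + x') \<cdot> (n + x')" by (simp add: n_def del: brk_linear brk_diff)
  also have "\<dots> = x' \<cdot> x'" using odd_commute[of x' n] by (simp add: nn nx)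
  finally show xx: "x' \<cdot> x' = 2 \<odot> e" by (simp add: square)
  have "2 \<odot> (y' \<cdot> x') = 2 \<odot> - h" using square_leibniz[of f x'] by (simp add: xx)
  then show yx: "y' \<cdot> x' = - h" by (metis vs.scale_left_imp_eq two_nz)
  then show xy: "x' \<cdot> y' = - h" using odd_commute[of x' y'] by simp
  show "y' \<cdot> y' = - (2 \<odot> f)" using leibniz[of f x' y'] by (simp add: xy)
qed

text \<open>\<open>square_act\<close> for \<open>x'\<close> shows that \<open>e\<close> kills
  \<open>z\<close>. Then \<open>y' \<cdot> z\<close> is a multiple of \<open>e\<close>, and isotropy
  against \<open>y' \<cdot> y' = - (2 \<odot> f)\<close> makes it 0. \<open>square_act\<close> for
  \<open>y'\<close> and \<open>odd_triple\<close> dispose of \<open>f\<close> and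
  \<open>h\<close>.\<close>

lemma orthogonal_trivial:
  assumes [simp]: "z \<in> V" and xz: "x' \<cdot> z = 0"
  shows "y' \<cdot> z = 0" "a \<in> L \<Longrightarrow> a \<cdot> z = 0"
proof -
  have "2 \<odot> (e \<cdot> z) = 0" using square_act[of x' z] by (simp add: xz)
  then have ez: "e \<cdot> z = 0" by simp
  have "e \<cdot> (y' \<cdot> z) = 0" using leibniz[of e y' z] by (simp add: xz ez)
  then obtain \<alpha> where \<alpha>: "y' \<cdot> z = \<alpha> \<odot> e" using centralizer[of e "y' \<cdot> z"] by auto
  have "F (y' \<cdot> y') (y' \<cdot> z) = 0" by (rule isotropic) simp_all
  then have "\<alpha> = 0" by (simp add: \<alpha>)
  then show yz: "y' \<cdot> z = 0" using \<alpha> by simp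
  have "2 \<odot> (f \<cdot> z) = 0" using square_act[of y' z] by (simp add: yz)
  then have fz: "f \<cdot> z = 0" by simp
  have hz: "h \<cdot> z = 0" using odd_triple[of x' y' z] odd_commute[of x' z] by (simp add: yz xz)
  show "a \<cdot> z = 0" if "a \<in> L" using act_0I[OF _ ez hz fz that] by simp
qed

text \<open>Bracketing with \<open>x'\<close> takes values in the span of \<open>e\<close> and
  \<open>h\<close>, which is already attained on \<open>x'\<close> and \<open>y'\<close>.\<close>

lemma V_split:
  assumes z: "z \<in> V" obtains \<alpha> \<beta> where "x' \<cdot> (z - \<alpha> \<odot> x' - \<beta> \<odot> y') = 0"
proof -
  obtain \<alpha> \<gamma> where "x' \<cdot> z = \<alpha> \<odot> e + \<gamma> \<odot> h" using brk_no_f[OF _ _ z, of x'] by auto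
  then have "x' \<cdot> (z - (\<alpha> / 2) \<odot> x' - (- \<gamma>) \<odot> y') = 0" using z by simp
  then show ?thesis by (rule that)
qed

text \<open>Vectors orthogonal to \<open>x'\<close> are invariant and orthogonal to
  \<open>y'\<close>; \<open>invariant_pair\<close> handles their mutual brackets.\<close>

lemma center_eq: "z \<in> center g \<longleftrightarrow> z \<in> V \<and> x' \<cdot> z = 0"
proof
  assume "z \<in> center g"
  then show "z \<in> V \<and> x' \<cdot> z = 0" by (simp add: center_odd center_act)
next
  assume z: "z \<in> V \<and> x' \<cdot> z = 0"
  note tr = orthogonal_trivial(2)
  show "z \<in> center g"
  proof (rule centerI)
    fix y assume y [simp]: "y \<in> V"
    obtain \<alpha> \<beta> where m: "x' \<cdot> (y - \<alpha> \<odot> x' - \<beta> \<odot> y') = 0" using y by (rule V_split)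
    let ?m = "y - \<alpha> \<odot> x' - \<beta> \<odot> y'"
    have "?m \<cdot> z = 0"
      by (rule invariant_pair) (use z tr[OF _ m] tr[of z] in auto)
    then show "y \<cdot> z = 0" using z orthogonal_trivial(1)[of z] by simp
  qed (use z tr in auto)
qed

text \<open>On trace-zero matrices this sends the standard \<open>sl\<^sub>2\<close> triple to
  \<open>e\<close>, \<open>h\<close>, \<open>f\<close>, and the unit vectors to \<open>x'\<close>
  and \<open>y'\<close>.\<close>

definition \<Phi> where
  "\<Phi> = (\<lambda>((A :: 'a^2^2, v :: 'a^2), z).
     (A $ 1 $ 1) \<odot> h + (A $ 1 $ 2) \<odot> e + (A $ 2 $ 1) \<odot> f + (v $ 1) \<odot> x' + (v $ 2) \<odot> y' + z)"

section \<open>The direct sum of the orthosymplectic model and the center\<close>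

abbreviation K where
  "K \<equiv> super_sum (osp12 :: ('a, ('a^2^2) \<times> ('a^2)) superalgebra) (center_algebra g)"

lemma K_homog:
  "((A, v), z) \<in> homog K 0 \<longleftrightarrow> A $ 1 $ 1 + A $ 2 $ 2 = 0 \<and> v = 0 \<and> z \<in> L \<inter> center g"
  "((A, v), z) \<in> homog K 1 \<longleftrightarrow> A = 0 \<and> z \<in> V \<inter> center g"
  by (auto simp: super_sum_def osp12_def center_algebra_def trace_2)

lemma K_carrier: "((A, v), z) \<in> super_carrier K \<longleftrightarrow> A $ 1 $ 1 + A $ 2 $ 2 = 0 \<and> z \<in> center g"
proof
  assume "((A, v), z) \<in> super_carrier K"
  then obtain A0 v0 z0 A1 v1 z1 where *: "((A0, v0), z0) \<in> homog K 0" "((A1, v1), z1) \<in> homog K 1"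
    "((A, v), z) = ((A0, v0), z0) + ((A1, v1), z1)"
    unfolding super_carrier_def by auto
  then show "A $ 1 $ 1 + A $ 2 $ 2 = 0 \<and> z \<in> center g"
    by (auto simp: K_homog center_add)
next
  assume a: "A $ 1 $ 1 + A $ 2 $ 2 = 0 \<and> z \<in> center g"
  then have "((A, 0), 0) \<in> homog K 0" "((0, v), z) \<in> homog K 1"
    using center_odd by (auto simp: K_homog center_zero)
  moreover have "((A, v), z) = ((A, 0), 0) + ((0, v), z)" by simp
  ultimately show "((A, v), z) \<in> super_carrier K" unfolding super_carrier_def by blast
qed

lemma Phi [simp]:
  "\<Phi> ((A, v), z) =
     (A $ 1 $ 1) \<odot> h + (A $ 1 $ 2) \<odot> e + (A $ 2 $ 1) \<odot> f + (v $ 1) \<odot> x' + (v $ 2) \<odot> y' + z"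
  by (simp add: \<Phi>_def)

lemma K_smul: "smul K c ((A, v), z) = ((map_matrix ((*) c) A, c *s v), c \<odot> z)"
proof -
  interpret m: module "\<lambda>c. map_matrix ((*) (c :: 'a)) :: 'a^2^2 \<Rightarrow> 'a^2^2"
    by unfold_locales (simp_all add: vec_eq_iff map_matrix_def algebra_simps)
  interpret v: module "(*s) :: 'a \<Rightarrow> 'a^2 \<Rightarrow> 'a^2"
    by unfold_locales (simp_all add: vec_eq_iff algebra_simps)
  interpret p1: module_prod "\<lambda>c. map_matrix ((*) (c :: 'a)) :: 'a^2^2 \<Rightarrow> 'a^2^2"
    "(*s) :: 'a \<Rightarrow> 'a^2 \<Rightarrow> 'a^2" by unfold_locales
  interpret p2: module_prod p1.scale "smul g" by unfold_locales
  show ?thesis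
    by (simp add: super_sum_def osp12_def center_algebra_def p2.scale_prod p1.scale_prod)
qed

lemma K_brk: "brk K ((A, v), z) ((B, w), z') =
    ((A ** B - B ** A + osp_odd_brk v w, A *v w - B *v v), z \<cdot> z')"
  by (simp add: super_sum_def osp12_def center_algebra_def)

lemma Phi_inj:
  assumes A: "A $ 1 $ 1 + A $ 2 $ 2 = 0" and z: "z \<in> center g" and 0: "\<Phi> ((A, v), z) = 0"
  shows "A = 0" "v = 0" "z = 0"
proof -
  have zc: "z \<in> V" "x' \<cdot> z = 0" using z center_eq by auto
  define a where "a = (A $ 1 $ 2) \<odot> e + (A $ 1 $ 1) \<odot> h + (A $ 2 $ 1) \<odot> f"
  define b where "b = (v $ 1) \<odot> x' + (v $ 2) \<odot> y' + z"
  have ab: "a \<in> L" "b \<in> V" using zc by (simp_all add: a_def b_def)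
  have "a + b = 0" using 0 by (simp add: a_def b_def add_ac)
  then have "a = - b" by (simp add: eq_neg_iff_add_eq_0)
  then have "a \<in> L \<inter> V" using ab by auto
  then have a0: "a = 0" using direct by auto
  then have b0: "b = 0" using \<open>a = - b\<close> by simp
  have "A $ 1 $ 2 = 0" "A $ 2 $ 1 = 0" "A $ 1 $ 1 = 0"
    using basis_independent[OF a0[unfolded a_def]] by auto
  then show "A = 0" using A by (simp add: vec_eq_iff forall_2)
  \<comment> \<open>Bracketing with \<open>x'\<close> kills \<open>z\<close> and turns the entries
    of \<open>v\<close> into coefficients of the independent \<open>e\<close> and
    \<open>h\<close>.\<close>
  have "x' \<cdot> b = 0" by (simp add: b0)
  then have "(2 * v $ 1) \<odot> e + (- (v $ 2)) \<odot> h + 0 \<odot> f = 0" using zc by (simp add: b_def mult.commute)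
  from basis_independent[OF this] have "v $ 1 = 0" "v $ 2 = 0" by simp_all
  then show "v = 0" by (simp add: vec_eq_iff forall_2)
  with b0 show "z = 0" by (simp add: b_def)
qed

lemma Phi_even: assumes "a \<in> L" shows "a \<in> \<Phi> ` homog K 0"
proof -
  obtain \<alpha> \<beta> \<gamma> where a: "a = \<alpha> \<odot> e + \<gamma> \<odot> h + \<beta> \<odot> f" using basis_expand[OF assms] by metis
  let ?k = "((vector [vector [\<gamma>, \<alpha>], vector [\<beta>, - \<gamma>]] :: 'a^2^2, 0), 0)"
  have "?k \<in> homog K 0" by (simp add: K_homog center_zero)
  moreover have "a = \<Phi> ?k" by (simp add: a add_ac)
  ultimately show ?thesis by blast
qed

lemma Phi_odd: assumes "y \<in> V" shows "y \<in> \<Phi> ` homog K 1"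
proof -
  obtain \<alpha> \<beta> where m: "x' \<cdot> (y - \<alpha> \<odot> x' - \<beta> \<odot> y') = 0" using assms by (rule V_split)
  let ?k = "((0, vector [\<alpha>, \<beta>]), y - \<alpha> \<odot> x' - \<beta> \<odot> y')"
  have "y - \<alpha> \<odot> x' - \<beta> \<odot> y' \<in> center g" using m assms by (simp add: center_eq del: brk_diff)
  then have "?k \<in> homog K 1" using assms by (simp add: K_homog)
  moreover have "y = \<Phi> ?k" by simp
  ultimately show ?thesis by blast
qed

lemma osp_iso: "super_iso g K"
proof (rule super_iso_inverseI[where \<Phi> = \<Phi>])
  have add: "a + b \<in> super_carrier K \<and> \<Phi> (a + b) = \<Phi> a + \<Phi> b"
    if "a \<in> super_carrier K" "b \<in> super_carrier K" for a b
  proof -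
    obtain A v z B w z' where ab: "a = ((A, v), z)" "b = ((B, w), z')" by (metis surj_pair)
    have "(A + B) $ 1 $ 1 + (A + B) $ 2 $ 2 = (A $ 1 $ 1 + A $ 2 $ 2) + (B $ 1 $ 1 + B $ 2 $ 2)"
      by (simp add: add_ac)
    then show ?thesis
      using that unfolding ab by (simp add: K_carrier center_add vs.scale_left_distrib add_ac)
  qed
  then show "a + b \<in> super_carrier K \<and> \<Phi> (a + b) = \<Phi> a + \<Phi> b"
    if "a \<in> super_carrier K" "b \<in> super_carrier K" for a b
    using that by blast
  have scale: "smul K c a \<in> super_carrier K \<and> \<Phi> (smul K c a) = c \<odot> \<Phi> a"
    if "a \<in> super_carrier K" for a c
  proof -
    obtain A v z where a: "a = ((A, v), z)" by (metis surj_pair)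
    show ?thesis
      using that unfolding a K_smul
      by (simp add: K_carrier center_scale map_matrix_def vs.scale_right_distrib flip: distrib_left)
  qed
  then show "smul K c a \<in> super_carrier K \<and> \<Phi> (smul K c a) = c \<odot> \<Phi> a"
    if "a \<in> super_carrier K" for a c
    using that by blast
  show sub: "homog K \<alpha> \<subseteq> super_carrier K" for \<alpha>
  proof
    fix a assume a: "a \<in> homog K \<alpha>"
    obtain A v z where "a = ((A, v), z)" by (metis surj_pair)
    then show "a \<in> super_carrier K" using a by (cases \<alpha>) (auto simp: K_homog K_carrier)
  qed
  show "homog g \<alpha> \<subseteq> \<Phi> ` homog K \<alpha>" for \<alpha>
    using Phi_even Phi_odd by (cases \<alpha>) auto
  show "bij_betw \<Phi> (super_carrier K) C"
    unfolding bij_betw_def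
  proof
    show "inj_on \<Phi> (super_carrier K)"
    proof (rule inj_onI)
      fix a b assume ab: "a \<in> super_carrier K" "b \<in> super_carrier K" "\<Phi> a = \<Phi> b"
      \<comment> \<open>The difference is written with \<open>smul\<close> so that the linearity of
        \<open>\<Phi>\<close> on the carrier applies.\<close>
      define d where "d = a + smul K (- 1) b"
      have d: "d \<in> super_carrier K" "\<Phi> d = 0"
        using ab add[of a "smul K (- 1) b"] scale[of b "- 1"] by (simp_all add: d_def)
      obtain A v z B w z' D u y where *: "a = ((A, v), z)" "b = ((B, w), z')" "d = ((D, u), y)" by (metis surj_pair)
      have "D = 0" "u = 0" "y = 0" using d Phi_inj[of D y u] unfolding * K_carrier by auto
      then have "a + smul K (- 1) b = 0" using d_def * by (simp add: zero_prod_def)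
      then have "A = - map_matrix ((*) (- 1)) B" "v = w" "z = z'"
        by (simp_all add: * K_smul zero_prod_def eq_neg_iff_add_eq_0)
      then show "a = b" by (simp add: * vec_eq_iff map_matrix_def)
    qed
    show "\<Phi> ` super_carrier K = C"
    proof (intro equalityI subsetI)
      fix y assume "y \<in> \<Phi> ` super_carrier K"
      then obtain A v z where "y = \<Phi> ((A, v), z)" "((A, v), z) \<in> super_carrier K" by auto
      then show "y \<in> C" using center_odd[of z] by (simp add: K_carrier)
    next
      fix y assume "y \<in> C"
      then obtain a v where y: "a \<in> L" "v \<in> V" "y = a + v" by (rule carrier_cases)
      obtain a' v' where "a' \<in> homog K 0" "a = \<Phi> a'" "v' \<in> homog K 1" "v = \<Phi> v'"
        using Phi_even[OF y(1)] Phi_odd[OF y(2)] by blast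
      then have "a' + v' \<in> super_carrier K" "y = \<Phi> (a' + v')"
        using add[of a' v'] subsetD[OF sub] y by simp_all
      then show "y \<in> \<Phi> ` super_carrier K" by blast
    qed
  qed
  show "brk K a b \<in> super_carrier K \<and> \<Phi> (brk K a b) = \<Phi> a \<cdot> \<Phi> b"
    if ab: "a \<in> super_carrier K" "b \<in> super_carrier K" for a b
  proof -
    obtain A v z B w z' where *: "a = ((A, v), z)" "b = ((B, w), z')" by (metis surj_pair)
    have z: "z \<in> center g" "z' \<in> center g" and A: "A $ 2 $ 2 = - (A $ 1 $ 1)" and B: "B $ 2 $ 2 = - (B $ 1 $ 1)"
      using ab by (simp_all add: * K_carrier eq_neg_iff_add_eq_0 add.commute)
    have zV [simp]: "z \<in> V" "z' \<in> V" using z center_odd by auto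
    have zz: "z \<cdot> z' = 0" using z by (simp add: center_act)
    note entries = matrix_matrix_mult_def matrix_vector_mult_def osp_odd_brk_def sum_2 Let_def A B
    have c: "brk K a b \<in> super_carrier K"
      by (simp add: * K_brk K_carrier zz center_zero entries)
    have xe: "x' \<cdot> e = 0" "x' \<cdot> h = - x'" "x' \<cdot> f = - y'" "y' \<cdot> e = - x'" "y' \<cdot> h = y'" "y' \<cdot> f = 0"
      by (simp_all add: even_skew)
    \<comment> \<open>Central terms drop out of both factors; what remains is a comparison of the
      bracket tables of the five basis vectors.\<close>
    have "\<Phi> a \<cdot> \<Phi> b =
      (A $ 1 $ 1 \<odot> h + A $ 1 $ 2 \<odot> e + A $ 2 $ 1 \<odot> f + v $ 1 \<odot> x' + v $ 2 \<odot> y') \<cdot>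
      (B $ 1 $ 1 \<odot> h + B $ 1 $ 2 \<odot> e + B $ 2 $ 1 \<odot> f + w $ 1 \<odot> x' + w $ 2 \<odot> y')"
      using z by (simp add: * center_act)
    also have "\<dots> = \<Phi> (brk K a b)"
      by (simp add: * K_brk zz entries xe vs.scale_left_distrib vs.scale_left_diff_distrib vs.scale_right_distrib)
       (simp add: algebra_simps scale_two)
    finally show ?thesis using c by simp
  qed
qed

end

section \<open>Case distinction by the isotropy of the odd squares\<close>

context cross_product_superalgebra
begin

lemma trichotomy:
  "(\<forall>x\<in>V. \<forall>y\<in>V. x \<cdot> y = 0) \<or>
   (\<exists>\<Theta>. rep_iso L
      (rep_sum (rep_sum (bracket_rep g L) trivial_rep) (bracket_rep g (center g)))
      (bracket_rep g V) \<Theta> \<and>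
    (\<forall>z\<in>center g. \<Theta> ((0, 0), z) = z) \<and>
    (\<forall>v\<in>L. \<forall>v'\<in>L. \<forall>l l'. \<forall>z\<in>center g. \<forall>z'\<in>center g.
       \<Theta> ((v, l), z) \<cdot> \<Theta> ((v', l'), z') = l' \<odot> v + l \<odot> v')) \<or>
   super_iso g (super_sum osp12 (center_algebra g))"
proof (cases "\<forall>x\<in>V. \<forall>y\<in>V. x \<cdot> y = 0")
  case False
  then obtain x where x: "x \<in> V" "x \<cdot> x \<noteq> 0" using square_nonzero by metis
  show ?thesis
  proof (cases "\<exists>y\<in>V. F (y \<cdot> y) (y \<cdot> y) \<noteq> 0")
    case True
    then obtain y where y: "y \<in> V" "F (y \<cdot> y) (y \<cdot> y) \<noteq> 0" by blast
    then obtain p where "p \<in> L" "F (y \<cdot> y) p = 0" "F p p \<noteq> 0"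
      using orthogonal_nonisotropic[of "y \<cdot> y"] by auto
    with y interpret semisimple_square g F y p by unfold_locales
    show ?thesis using adjoint_plus_trivial by blast
  next
    case False
    then have iso: "F (y \<cdot> y) (y \<cdot> y) = 0" if "y \<in> V" for y using that by blast
    \<comment> \<open>Halving the square matches the normalisation of \<open>sl2_square\<close>;
      \<open>isotropic_partner\<close> completes \<open>e\<close> to a hyperbolic pair.\<close>
    define e where "e = (1 / 2) \<odot> (x \<cdot> x)"
    have e: "e \<in> L" "e \<noteq> 0" "F e e = 0" "x \<cdot> x = 2 \<odot> e"
      using x iso[of x] by (simp_all add: e_def)
    from e(1-3) obtain f where "f \<in> L" "F f f = 0" "F e f = 2" by (rule isotropic_partner)
    with x e interpret sl2_square g F x e f
      by unfold_locales (use isotropic_polarise[OF iso] in auto)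
    show ?thesis using osp_iso by blast
  qed
qed blast

end

theorem theorem6p7:
  fixes g :: "('k::field, 'v::ab_group_add) superalgebra"
  assumes "CHAR('k) \<noteq> 2" and "CHAR('k) \<noteq> 3"
    and "lie_superalgebra g"
    and "finite_dimensional g"
    and "simple_lie_algebra (smul g) (homog g 0) (brk g)"
    and "vector_space.dim (smul g) (homog g 0) = 3"
  shows "(\<forall>x\<in>homog g 1. \<forall>y\<in>homog g 1. brk g x y = 0) \<or>
    (\<exists>\<theta>. rep_iso (homog g 0)
            (rep_sum (rep_sum (bracket_rep g (homog g 0)) trivial_rep) (bracket_rep g (center g)))
            (bracket_rep g (homog g 1)) \<theta> \<and>
          (\<forall>z\<in>center g. \<theta> ((0, 0), z) = z) \<and>
          (\<forall>v\<in>homog g 0. \<forall>v'\<in>homog g 0. \<forall>l l'. \<forall>z\<in>center g. \<forall>z'\<in>center g.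
             brk g (\<theta> ((v, l), z)) (\<theta> ((v', l'), z')) = smul g l' v + smul g l v')) \<or>
    super_iso g (super_sum osp12 (center_algebra g))"
proof -
  interpret simple_lie_algebra "smul g" "homog g 0" "brk g" by (rule assms(5))
  obtain F where F:
    "\<And>x y. F x y = F y x"
    "\<And>x y z. \<lbrakk>x \<in> homog g 0; y \<in> homog g 0\<rbrakk> \<Longrightarrow> F (x + y) z = F x z + F y z"
    "\<And>c x z. x \<in> homog g 0 \<Longrightarrow> F (smul g c x) z = c * F x z"
    "\<And>x y z. \<lbrakk>x \<in> homog g 0; y \<in> homog g 0; z \<in> homog g 0\<rbrakk> \<Longrightarrow>
      brk g x (brk g y z) = smul g (F x y) z - smul g (F x z) y"
    "\<And>x. \<lbrakk>x \<in> homog g 0; \<forall>y\<in>homog g 0. F x y = 0\<rbrakk> \<Longrightarrow> x = 0"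
    by (rule cross_product_form[OF assms(6)]) (rule that)
  interpret cross_product_superalgebra g F
    using assms(3) two_three_nonzero[OF assms(1,2)] F nonabelian
    unfolding cross_product_superalgebra_def lie_superalgebra_char_not_2_3_def lie_superalgebra_char_not_2_3_axioms_def
      cross_product_superalgebra_axioms_def by blast
  show ?thesis by (rule trichotomy)
qed

end
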